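(* Suppose $\gamma>0$ is such that $\mathcal{H}_{11,\gamma}^-$ is not empty. Then every element $H_{11}(s)$ of $\mathcal{H}_{11,\gamma}^-$ satisfies all three of the following conditions: (H1) all poles of $H_{11}(s)$ are in the open left half-plane, and $H_{11}(s)$ is analytic in a half-plane $\mathrm{Re}\,s>-\tau$ for some $\tau>0$; (H2) $H_{11}(i\omega)H_{11}(i\omega)^\dagger\le I_n$ for all $\omega\in\mathbf{R}$; (H3) the normal rank of each of the matrices $Z_1(s)=I_n-H_{11}(s)H_{11}(s)^H$ and $Z_2(s)=I_{n_y}-H_{11}(s)^HH_{11}(s)$ does not change on the finite imaginary axis (i.e. for $j=1,2$ the rank of $Z_j(i\omega)$ equals the normal rank of $Z_j$ for every $\omega\in\mathbf{R}$). As a result, for every $H_{11}\in\mathcal{H}_{11,\gamma}^-$ there is an admissible physically realizable filter transfer function $H(s)\in\mathcal{H}_p$ having this $H_{11}(s)$ as its $(1,1)$ block, and for this $H$ it holds that $P_e(i\omega)<\gamma^2I_n$ for all $\omega\in\mathbf{R}$. The infimal equalization performance among all admissible $H(s)$ constructed this way, i.e. the infimum of all $\gamma>0$ for which there exists $H\in\mathcal{H}_p$ whose $(1,1)$ block belongs to $\mathcal{H}_{11,\gamma}^-$, is equal to $\gamma_\circ''$; therefore $$\gamma_\circ''\ge\gamma_\circ .$$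
   Context: Notation. $^\dagger$ is the complex conjugate transpose of a matrix, $^T$ the transpose, $X(s)^H\triangleq X(-s^* )^\dagger$ for a rational matrix function $X$, $I_k$ the $k\times k$ identity matrix. Inequalities between Hermitian matrices are in the positive (semi)definite order. $\bar{\mathbf{R}}=\mathbf{R}\cup\{\pm\infty\}$. The normal rank of a rational matrix $X(s)$ is the integer $r\ge 0$ such that some minor of order $r$ does not vanish identically while all minors of order greater than $r$ vanish identically. Channel. $n,n_w,n_y,n_d$ are dimensions with $n_y+n_d=n+n_w$. The channel is given by complex matrices $A,B,C,D$, with $A$ Hurwitz, satisfying $A+A^\dagger+BB^\dagger=0$, $B=-C^\dagger D$, $D^\dagger D=DD^\dagger=I_{n+n_w}$, and $(A,B,C,D)$ is a minimal realization of the $(n_y+n_d)\times(n+n_w)$ transfer function $G(s)=D+C(sI-A)^{-1}B$ (so that $G(s)^HG(s)=G(s)G(s)^H=I_{n+n_w}$). $G$ is partitioned as $G=\begin{bmatrix}G_{11}&G_{12}\\ G_{21}&G_{22}\end{bmatrix}$ with $G_{11}$ of size $n_y\times n$ and $G_{12}$ of size $n_y\times n_w$. $\Sigma_u$ ($n\times n$) and $\Sigma_w$ ($n_w\times n_w$) are Hermitian positive definite matrices (signal and noise intensities). Define $$\Psi(s)=G_{11}(s)\Sigma_u^TG_{11}(s)^H+G_{12}(s)\Sigma_w^TG_{12}(s)^H,$$ $$\Phi(s)=\begin{bmatrix}\Psi(s)&-G_{11}(s)(I_n+\Sigma_u^T)\\ -(I_n+\Sigma_u^T)G_{11}(s)^H&\Sigma_u^T+2I_n\end{bmatrix}.$$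 Filters. $\mathcal{H}_p$ is the set of admissible (completely passive, physically realizable) equalizers: stable rational $n_f\times n_f$ transfer functions $H(s)$ in the Hardy space $H_\infty$, $n_f=n_y+n_z\ge n$ (the number $n_z$ of filter environment inputs is not fixed in advance), analytic in $\mathrm{Re}\,s>-\tau$ for some $\tau>0$, and paraunitary: $H(s)^HH(s)=H(s)H(s)^H=I$. Such $H$ is partitioned as $H=\begin{bmatrix}H_{11}&H_{12}\\ H_{21}&H_{22}\end{bmatrix}$ with $H_{11}$ of size $n\times n_y$. The power spectrum density of the equalization error depends only on $H_{11}$ and is $$P_e(s)=\begin{bmatrix}H_{11}(s)&I_n\end{bmatrix}\Phi(s)\begin{bmatrix}H_{11}(s)^H\\ I_n\end{bmatrix}.$$ Optimal performance: $\gamma_\circ$ is the infimum of all $\gamma>0$ for which there exists $H\in\mathcal{H}_p$ with $P_e(i\omega)<\gamma^2I_n$ for all $\omega\in\mathbf{R}$. For $\gamma>0$, $\mathcal{H}_{11,\gamma}^-$ is the set of proper rational $n\times n_y$ transfer functions $H_{11}(s)$ such that: all poles of $H_{11}$ lie in the open left half-plane and $H_{11}$ is analytic in $\mathrm{Re}\,s>-\tau$ for some $\tau>0$; $P_e(i\omega)<\gamma^2I_n$ for all $\omega\in\mathbf{R}$; and $H_{11}(i\omega)H_{11}(i\omega)^\dagger<I_n$ for all $\omega\in\bar{\mathbf{R}}$. Further, $\gamma_\circ''\triangleq\inf\{\gamma>0:\mathcal{H}_{11,\gamma}^-\ne\emptyset\}$. *)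

theory Defs
  imports
    "HOL-Analysis.Analysis"
    "HOL-Computational_Algebra.Polynomial_Factorial"
    "HOL-Computational_Algebra.Field_as_Ring"
    "Jordan_Normal_Form.Char_Poly"
    "Jordan_Normal_Form.Gauss_Jordan_Elimination"
    "Jordan_Normal_Form.Schur_Decomposition"
    "Jordan_Normal_Form.DL_Rank"
    "Jordan_Normal_Form.DL_Submatrix"
begin

text \<open>Rational functions are elements of the field of fractions of the polynomial ring, so that
  identities between rational matrices are identities in that field. Poles and values are read off
  from the representation in lowest terms; the value at a pole is the junk value 0, so a rational
  function with a pole is not continuous, hence not holomorphic, there.\<close>

type_synonym rat_fun = "complex poly fract"

definition rat_num :: "rat_fun \<Rightarrow> complex poly" where
  "rat_num f = fst (quot_of_fract f)"

definition rat_den :: "rat_fun \<Rightarrow> complex poly" where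
  "rat_den f = snd (quot_of_fract f)"

definition rat_eval :: "rat_fun \<Rightarrow> complex \<Rightarrow> complex" where
  "rat_eval f s = poly (rat_num f) s / poly (rat_den f) s"

definition rat_poles :: "rat_fun \<Rightarrow> complex set" where
  "rat_poles f = {s. poly (rat_den f) s = 0}"

definition rat_proper :: "rat_fun \<Rightarrow> bool" where
  "rat_proper f \<longleftrightarrow> degree (rat_num f) \<le> degree (rat_den f)"

definition rat_const :: "complex \<Rightarrow> rat_fun" where
  "rat_const c = to_fract [:c:]"

text \<open>Values on the extended imaginary axis; at the two infinite points the value is the limit
  along the axis (it exists for proper functions).\<close>

definition rat_axis_val :: "rat_fun \<Rightarrow> ereal \<Rightarrow> complex" where
  "rat_axis_val f \<omega> = (case \<omega> of
      ereal t \<Rightarrow> rat_eval f (\<i> * complex_of_real t)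
    | PInfty \<Rightarrow> Lim at_top (\<lambda>t::real. rat_eval f (\<i> * complex_of_real t))
    | MInfty \<Rightarrow> Lim at_bot (\<lambda>t::real. rat_eval f (\<i> * complex_of_real t)))"

text \<open>The polynomial \<open>s \<mapsto> cnj (p (- cnj s))\<close> and the corresponding operation on fractions;
  see \<open>rat_eval_para\<close> below.\<close>

definition poly_para :: "complex poly \<Rightarrow> complex poly" where
  "poly_para p = pcompose (map_poly cnj p) [:0, -1:]"

definition rat_para :: "rat_fun \<Rightarrow> rat_fun" where
  "rat_para f = Fraction_Field.Fract (poly_para (rat_num f)) (poly_para (rat_den f))"

lemma poly_poly_para: "poly (poly_para p) s = cnj (poly p (- cnj s))"
proof -
  have "poly (map_poly cnj q) z = cnj (poly q (cnj z))" for q z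
    by (induction q) (simp_all add: map_poly_pCons)
  then show ?thesis
    by (simp add: poly_para_def poly_pcompose)
qed

lemma poly_para_nonzero: "poly_para p \<noteq> 0" if "p \<noteq> 0"
proof
  assume *: "poly_para p = 0"
  have "poly p z = 0" for z
    using poly_poly_para[of p "- cnj z"] by (simp add: *)
  then show False
    using that poly_all_0_iff_0 by blast
qed

lemma rat_no_common_root: "poly (rat_num f) s \<noteq> 0 \<or> poly (rat_den f) s \<noteq> 0"
proof (rule ccontr)
  assume "\<not> ?thesis"
  then have "[:-s, 1:] dvd rat_num f" "[:-s, 1:] dvd rat_den f"
    by (simp_all add: poly_eq_0_iff_dvd)
  moreover have "coprime (rat_num f) (rat_den f)"
    unfolding rat_num_def rat_den_def by (rule coprime_quot_of_fract)
  ultimately have "is_unit [:-s, 1:]"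
    by (rule coprime_common_divisor[rotated])
  then show False
    by (simp add: is_unit_pCons_iff)
qed

lemma rat_eval_Fract:
  assumes "b \<noteq> 0" and no_root: "poly a s \<noteq> 0 \<or> poly b s \<noteq> 0"
  shows "rat_eval (Fraction_Field.Fract a b) s = poly a s / poly b s"
    and "s \<in> rat_poles (Fraction_Field.Fract a b) \<longleftrightarrow> poly b s = 0"
proof -
  define f where "f = Fraction_Field.Fract a b"
  have "Fraction_Field.Fract (rat_num f) (rat_den f) = Fraction_Field.Fract a b"
    by (simp add: f_def rat_num_def rat_den_def)
  moreover have "rat_den f \<noteq> 0"
    by (simp add: rat_den_def)
  ultimately have "rat_num f * b = a * rat_den f"
    using \<open>b \<noteq> 0\<close> by (simp add: eq_fract)
  then have eq: "poly (rat_num f) s * poly b s = poly a s * poly (rat_den f) s"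
    by (metis poly_mult)
  have iff: "poly (rat_den f) s = 0 \<longleftrightarrow> poly b s = 0"
    using eq no_root rat_no_common_root[of f s] by auto
  then show "s \<in> rat_poles (Fraction_Field.Fract a b) \<longleftrightarrow> poly b s = 0"
    by (simp add: rat_poles_def f_def)
  show "rat_eval (Fraction_Field.Fract a b) s = poly a s / poly b s"
    using eq iff by (cases "poly b s = 0") (simp_all add: rat_eval_def frac_eq_eq flip: f_def)
qed

lemma rat_eval_para: "rat_eval (rat_para f) s = cnj (rat_eval f (- cnj s))"
proof -
  have nz: "poly_para (rat_den f) \<noteq> 0"
    by (rule poly_para_nonzero) (simp add: rat_den_def)
  have "poly (poly_para (rat_num f)) s \<noteq> 0 \<or> poly (poly_para (rat_den f)) s \<noteq> 0"
    using rat_no_common_root[of f "- cnj s"] by (simp add: poly_poly_para)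
  from rat_eval_Fract(1)[OF nz this] show ?thesis
    by (simp add: rat_para_def poly_poly_para rat_eval_def[of f])
qed

type_synonym rat_mat = "rat_fun mat"

abbreviation const_mat :: "complex mat \<Rightarrow> rat_mat" where
  "const_mat M \<equiv> map_mat rat_const M"

abbreviation eval_mat :: "rat_mat \<Rightarrow> complex \<Rightarrow> complex mat" where
  "eval_mat X s \<equiv> map_mat (\<lambda>f. rat_eval f s) X"

text \<open>The matrix \<open>X(s)\<^sup>H = X(- cnj s)\<^sup>\<dagger>\<close>.\<close>

definition para_adjoint :: "rat_mat \<Rightarrow> rat_mat" where
  "para_adjoint X = transpose_mat (map_mat rat_para X)"

lemma eval_mat_para_adjoint: "eval_mat (para_adjoint X) s = mat_adjoint (eval_mat X (- cnj s))"
  by (rule eq_matI) (auto simp: para_adjoint_def mat_adjoint_def mat_of_rows_def rat_eval_para)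

definition pos_def :: "complex mat \<Rightarrow> bool" where
  "pos_def M \<longleftrightarrow> square_mat M \<and> mat_adjoint M = M \<and>
     (\<forall>v \<in> carrier_vec (dim_row M). v \<noteq> 0\<^sub>v (dim_row M) \<longrightarrow> 0 < Re ((M *\<^sub>v v) \<bullet>c v))"

definition pos_semidef :: "complex mat \<Rightarrow> bool" where
  "pos_semidef M \<longleftrightarrow> square_mat M \<and> mat_adjoint M = M \<and>
     (\<forall>v \<in> carrier_vec (dim_row M). 0 \<le> Re ((M *\<^sub>v v) \<bullet>c v))"

definition loewner_less :: "complex mat \<Rightarrow> complex mat \<Rightarrow> bool" (infix \<open>\<prec>\<^sub>L\<close> 50) where
  "X \<prec>\<^sub>L Y \<longleftrightarrow> pos_def (Y - X)"

definition loewner_le :: "complex mat \<Rightarrow> complex mat \<Rightarrow> bool" (infix \<open>\<preceq>\<^sub>L\<close> 50) where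
  "X \<preceq>\<^sub>L Y \<longleftrightarrow> pos_semidef (Y - X)"

definition hcat :: "'a::zero mat \<Rightarrow> 'a mat \<Rightarrow> 'a mat" where
  "hcat X Y = four_block_mat X Y (0\<^sub>m 0 (dim_col X)) (0\<^sub>m 0 (dim_col Y))"

definition block11 :: "nat \<Rightarrow> nat \<Rightarrow> 'a mat \<Rightarrow> 'a mat" where
  "block11 r c X = (case split_block X r c of (X11, X12, X21, X22) \<Rightarrow> X11)"

definition block12 :: "nat \<Rightarrow> nat \<Rightarrow> 'a mat \<Rightarrow> 'a mat" where
  "block12 r c X = (case split_block X r c of (X11, X12, X21, X22) \<Rightarrow> X12)"

definition has_nonzero_minor :: "rat_mat \<Rightarrow> nat \<Rightarrow> bool" where
  "has_nonzero_minor X r \<longleftrightarrow>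
     (\<exists>I J. I \<subseteq> {..<dim_row X} \<and> J \<subseteq> {..<dim_col X} \<and> card I = r \<and> card J = r \<and>
        det (submatrix X I J) \<noteq> 0)"

definition normal_rank :: "rat_mat \<Rightarrow> nat" where
  "normal_rank X = (THE r. has_nonzero_minor X r \<and> (\<forall>r'>r. \<not> has_nonzero_minor X r'))"

lemma normal_rank_wellposed:
  "\<exists>!r. has_nonzero_minor X r \<and> (\<forall>r'>r. \<not> has_nonzero_minor X r')"
proof -
  let ?R = "{r. has_nonzero_minor X r}"
  have "?R \<subseteq> {..dim_row X}"
    using card_mono[of "{..<dim_row X}"] by (auto simp: has_nonzero_minor_def)
  then have fin: "finite ?R"
    by (rule finite_subset) simp
  have "has_nonzero_minor X 0"
    unfolding has_nonzero_minor_def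
    by (rule exI[of _ "{}"], rule exI[of _ "{}"]) (simp add: submatrix_def)
  then have "Max ?R \<in> ?R" and "\<forall>r\<in>?R. r \<le> Max ?R"
    using fin Max_in[of ?R] Max_ge[of ?R] by auto
  then show ?thesis
    by (metis (mono_tags, lifting) leD linorder_neqE_nat mem_Collect_eq)
qed

definition hurwitz :: "complex mat \<Rightarrow> bool" where
  "hurwitz A \<longleftrightarrow> (\<forall>l. eigenvalue A l \<longrightarrow> Re l < 0)"

text \<open>\<open>D + C (s I - A)\<^sup>-\<^sup>1 B\<close>. Here \<open>char_poly_matrix A\<close> is \<open>s I - A\<close>, which is always invertible
  over the field of rational functions.\<close>

definition transfer_function ::
  "complex mat \<Rightarrow> complex mat \<Rightarrow> complex mat \<Rightarrow> complex mat \<Rightarrow> rat_mat" where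
  "transfer_function A B C D =
     const_mat D + const_mat C * the (mat_inverse (map_mat to_fract (char_poly_matrix A))) * const_mat B"

text \<open>State dimension \<open>m\<close>, \<open>p\<close> outputs, \<open>q\<close> inputs. Minimality means that the state dimension is
  least among all realizations of the same transfer function.\<close>

definition realization_dims ::
  "nat \<Rightarrow> nat \<Rightarrow> nat \<Rightarrow> complex mat \<Rightarrow> complex mat \<Rightarrow> complex mat \<Rightarrow> complex mat \<Rightarrow> bool" where
  "realization_dims m p q A B C D \<longleftrightarrow> A \<in> carrier_mat m m \<and> B \<in> carrier_mat m q \<and>
     C \<in> carrier_mat p m \<and> D \<in> carrier_mat p q"

definition minimal_realization ::
  "nat \<Rightarrow> nat \<Rightarrow> nat \<Rightarrow> complex mat \<Rightarrow> complex mat \<Rightarrow> complex mat \<Rightarrow> complex mat \<Rightarrow> bool" where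
  "minimal_realization m p q A B C D \<longleftrightarrow> realization_dims m p q A B C D \<and>
     (\<forall>m' A' B' C' D'. realization_dims m' p q A' B' C' D' \<and>
        transfer_function A' B' C' D' = transfer_function A B C D \<longrightarrow> m \<le> m')"

text \<open>Analyticity in \<open>Re s > - \<tau>\<close> already follows from the location of the finitely many poles;
  both are recorded.\<close>

definition stable_rat :: "rat_mat \<Rightarrow> bool" where
  "stable_rat X \<longleftrightarrow> (\<forall>f \<in> elements_mat X. rat_poles f \<subseteq> {s. Re s < 0}) \<and>
     (\<exists>\<tau>>0. \<forall>f \<in> elements_mat X. rat_eval f holomorphic_on {s. Re s > - \<tau>})"

text \<open>Membership in \<open>H\<^sub>\<infinity>\<close> of the open right half-plane; boundedness of the matrix is
  boundedness of its entries.\<close>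

definition hardy_inf :: "rat_mat \<Rightarrow> bool" where
  "hardy_inf X \<longleftrightarrow> (\<forall>f \<in> elements_mat X. rat_eval f holomorphic_on {s. Re s > 0} \<and>
     bounded (rat_eval f ` {s. Re s > 0}))"

definition paraunitary :: "rat_mat \<Rightarrow> bool" where
  "paraunitary H \<longleftrightarrow> para_adjoint H * H = 1\<^sub>m (dim_col H) \<and> H * para_adjoint H = 1\<^sub>m (dim_row H)"

definition Psi :: "nat \<Rightarrow> nat \<Rightarrow> complex mat \<Rightarrow> complex mat \<Rightarrow> rat_mat \<Rightarrow> rat_mat" where
  "Psi n ny Su Sw G =
     block11 ny n G * const_mat (transpose_mat Su) * para_adjoint (block11 ny n G) +
     block12 ny n G * const_mat (transpose_mat Sw) * para_adjoint (block12 ny n G)"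

definition Phi :: "nat \<Rightarrow> nat \<Rightarrow> complex mat \<Rightarrow> complex mat \<Rightarrow> rat_mat \<Rightarrow> rat_mat" where
  "Phi n ny Su Sw G = four_block_mat
     (Psi n ny Su Sw G)
     (- (block11 ny n G * (1\<^sub>m n + const_mat (transpose_mat Su))))
     (- ((1\<^sub>m n + const_mat (transpose_mat Su)) * para_adjoint (block11 ny n G)))
     (const_mat (transpose_mat Su) + 2 \<cdot>\<^sub>m 1\<^sub>m n)"

definition error_psd ::
  "nat \<Rightarrow> nat \<Rightarrow> complex mat \<Rightarrow> complex mat \<Rightarrow> rat_mat \<Rightarrow> rat_mat \<Rightarrow> rat_mat" where
  "error_psd n ny Su Sw G H11 =
     hcat H11 (1\<^sub>m n) * Phi n ny Su Sw G * (para_adjoint H11 @\<^sub>r 1\<^sub>m n)"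

definition error_below ::
  "nat \<Rightarrow> nat \<Rightarrow> complex mat \<Rightarrow> complex mat \<Rightarrow> rat_mat \<Rightarrow> real \<Rightarrow> rat_mat \<Rightarrow> bool" where
  "error_below n ny Su Sw G \<gamma> H11 \<longleftrightarrow>
     (\<forall>\<omega>::real. eval_mat (error_psd n ny Su Sw G H11) (\<i> * complex_of_real \<omega>)
        \<prec>\<^sub>L complex_of_real (\<gamma>\<^sup>2) \<cdot>\<^sub>m 1\<^sub>m n)"

text \<open>\<open>nz\<close> is the number of environment inputs of the filter, which is not prescribed.\<close>

definition admissible :: "nat \<Rightarrow> nat \<Rightarrow> rat_mat set" where
  "admissible n ny = {H. \<exists>nz. n \<le> ny + nz \<and> H \<in> carrier_mat (ny + nz) (ny + nz) \<and>
     stable_rat H \<and> hardy_inf H \<and> paraunitary H}"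

definition gamma_opt :: "nat \<Rightarrow> nat \<Rightarrow> complex mat \<Rightarrow> complex mat \<Rightarrow> rat_mat \<Rightarrow> real" where
  "gamma_opt n ny Su Sw G =
     Inf {\<gamma>. \<gamma> > 0 \<and> (\<exists>H \<in> admissible n ny. error_below n ny Su Sw G \<gamma> (block11 n ny H))}"

definition H11_minus ::
  "nat \<Rightarrow> nat \<Rightarrow> complex mat \<Rightarrow> complex mat \<Rightarrow> rat_mat \<Rightarrow> real \<Rightarrow> rat_mat set" where
  "H11_minus n ny Su Sw G \<gamma> = {H11 \<in> carrier_mat n ny.
     (\<forall>f \<in> elements_mat H11. rat_proper f) \<and> stable_rat H11 \<and>
     error_below n ny Su Sw G \<gamma> H11 \<and>
     (\<forall>\<omega>::ereal. map_mat (\<lambda>f. rat_axis_val f \<omega>) H11 * mat_adjoint (map_mat (\<lambda>f. rat_axis_val f \<omega>) H11)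
        \<prec>\<^sub>L 1\<^sub>m n)}"

definition gamma_opt'' :: "nat \<Rightarrow> nat \<Rightarrow> complex mat \<Rightarrow> complex mat \<Rightarrow> rat_mat \<Rightarrow> real" where
  "gamma_opt'' n ny Su Sw G = Inf {\<gamma>. \<gamma> > 0 \<and> H11_minus n ny Su Sw G \<gamma> \<noteq> {}}"

definition rank_const_on_axis :: "rat_mat \<Rightarrow> bool" where
  "rank_const_on_axis Z \<longleftrightarrow>
     (\<forall>\<omega>::real. vec_space.rank (dim_row Z) (eval_mat Z (\<i> * complex_of_real \<omega>)) = normal_rank Z)"

end

theory Submission
  imports Defs
begin

text \<open>The bound on the error spectrum sees only the \<open>(1,1)\<close> block of the filter. So everything reduces to
  one fact about a stable rational matrix \<open>K\<close> that is a strict contraction at every point of the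
  imaginary axis: it is the \<open>(1,1)\<close> block of a stable paraunitary matrix (\<open>contraction_dilation\<close>). Given this, every \<open>\<gamma>\<close>
  over which \<open>gamma_opt''\<close> takes the infimum is also attained by an admissible filter, and the relations
  between the infima are comparisons of sets. The rank conditions hold because \<open>I - K K\<^sup>H\<close> and
  \<open>I - K\<^sup>H K\<close> are positive definite on the whole axis, the second by \<open>pos_def_gram_defect_swap\<close>, so that both have full rank everywhere.

  The dilation is first built without regard to stability. Over the field of rational
  functions with the involution \<open>X \<mapsto> X\<^sup>H\<close> the matrices \<open>I - K K\<^sup>H = F F\<^sup>H\<close> and \<open>I - K\<^sup>H K = E\<^sup>H E\<close> factor
  by a Cholesky decomposition (\<open>mat_spectral_factor\<close>), since every scalar pivot, being nonnegative on the
  axis, is of the form \<open>g g\<^sup>H\<close> (\<open>rat_spectral_factor\<close>). As for a constant contraction, \<open>K\<close>, \<open>F\<close>, \<open>E\<close> and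
  \<open>X = - E K\<^sup>H F\<^sup>-\<^sup>H\<close> form a paraunitary matrix (\<open>paraunitary_completion\<close>). Its poles outside \<open>K\<close> are
  arbitrary so far. Those in the open right half-plane are removed by multiplying the new rows and
  columns by a scalar Blaschke product (\<open>blaschke_for_finite_set\<close>), which has modulus one on the axis. Poles
  on the axis and at infinity cannot occur, because the entries of a unitary matrix are bounded by one
  (\<open>paraunitary_axis_bounded\<close>).

  Identities between values of rational matrices are used away from the poles, and inequalities on the
  axis for all but finitely many frequencies, that is, along the filter \<open>cofinite\<close>; \<open>nonneg_of_cofinite\<close>
  recovers the exceptional frequencies where polynomials are compared.\<close>

section \<open>The involution on rational functions\<close>

lemma rat_num_den: "Fraction_Field.Fract (rat_num f) (rat_den f) = f" "rat_den f \<noteq> 0"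
  by (simp_all add: rat_num_def rat_den_def)

lemma rat_num_den_cross: "b \<noteq> 0 \<Longrightarrow> rat_num (Fraction_Field.Fract a b) * b = a * rat_den (Fraction_Field.Fract a b)"
  using rat_num_den[of "Fraction_Field.Fract a b"] by (metis eq_fract(1))

lemma poly_eqI_eval: "(\<And>x. poly p x = poly q x) \<Longrightarrow> p = (q::complex poly)"
  by (simp add: poly_eq_poly_eq_iff[symmetric] ext)

lemma poly_para_mult: "poly_para (p * q) = poly_para p * poly_para q"
  and poly_para_add: "poly_para (p + q) = poly_para p + poly_para q"
  and poly_para_para: "poly_para (poly_para p) = p"
  and poly_para_1: "poly_para 1 = 1"
  and poly_para_0: "poly_para 0 = 0"
  by (rule poly_eqI_eval; simp add: poly_poly_para)+

lemma rat_para_Fract: "b \<noteq> 0 \<Longrightarrow> rat_para (Fraction_Field.Fract a b) = Fraction_Field.Fract (poly_para a) (poly_para b)"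
  unfolding rat_para_def
  using arg_cong[OF rat_num_den_cross[of b a], of poly_para]
  by (simp add: eq_fract poly_para_nonzero rat_num_den poly_para_mult)

lemma rat_para_mult: "rat_para (f * g) = rat_para f * rat_para g"
  by (cases f; cases g) (simp add: rat_para_Fract poly_para_mult)

lemma rat_para_add: "rat_para (f + g) = rat_para f + rat_para g"
  by (cases f; cases g) (simp add: rat_para_Fract poly_para_mult poly_para_add poly_para_nonzero)

lemma rat_para_para: "rat_para (rat_para f) = f"
  by (cases f) (simp add: rat_para_Fract poly_para_para poly_para_nonzero)

lemma rat_para_1: "rat_para 1 = 1"
  by (simp add: One_fract_def rat_para_Fract poly_para_1)

lemma rat_para_0: "rat_para 0 = 0"
  by (simp add: Zero_fract_def rat_para_Fract poly_para_1 poly_para_0)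

lemma rat_para_minus: "rat_para (- f) = - rat_para f"
  by (metis add.right_inverse minus_unique rat_para_0 rat_para_add)

lemma rat_para_diff: "rat_para (f - g) = rat_para f - rat_para g"
  using rat_para_add[of f "- g"] by (simp add: rat_para_minus)

lemma rat_para_inverse: "rat_para (inverse f) = inverse (rat_para f)"
  by (metis inverse_unique inverse_zero rat_para_0 rat_para_1 rat_para_mult right_inverse)

lemma rat_para_sum: "rat_para (sum f A) = (\<Sum>x\<in>A. rat_para (f x))"
  by (induction A rule: infinite_finite_induct) (simp_all add: rat_para_0 rat_para_add)

section \<open>Values of rational functions away from poles\<close>

lemma not_rat_polesI: "poly b s \<noteq> 0 \<Longrightarrow> s \<notin> rat_poles (Fraction_Field.Fract a b)"
  by (subst rat_eval_Fract(2)) auto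

lemma regular_cases:
  assumes "s \<notin> rat_poles f"
  obtains a b where "f = Fraction_Field.Fract a b" "b \<noteq> 0" "poly b s \<noteq> 0" "rat_eval f s = poly a s / poly b s"
  by (rule that[of "rat_num f" "rat_den f"])
    (use assms in \<open>simp_all add: rat_num_den rat_poles_def rat_eval_def\<close>)

lemma rat_eval_add: 
  assumes "s \<notin> rat_poles f" "s \<notin> rat_poles g"
  shows "s \<notin> rat_poles (f + g) \<and> rat_eval (f + g) s = rat_eval f s + rat_eval g s"
proof -
  obtain a b c d where *: "f = Fraction_Field.Fract a b" "b \<noteq> 0" "poly b s \<noteq> 0" "rat_eval f s = poly a s / poly b s"
     "g = Fraction_Field.Fract c d" "d \<noteq> 0" "poly d s \<noteq> 0" "rat_eval g s = poly c s / poly d s"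
    using assms by (metis regular_cases)
  show ?thesis
    by (simp add: * rat_eval_Fract add_frac_eq)
qed

lemma rat_eval_mult: 
  assumes "s \<notin> rat_poles f" "s \<notin> rat_poles g"
  shows "s \<notin> rat_poles (f * g) \<and> rat_eval (f * g) s = rat_eval f s * rat_eval g s"
proof -
  obtain a b c d where *: "f = Fraction_Field.Fract a b" "b \<noteq> 0" "poly b s \<noteq> 0" "rat_eval f s = poly a s / poly b s"
     "g = Fraction_Field.Fract c d" "d \<noteq> 0" "poly d s \<noteq> 0" "rat_eval g s = poly c s / poly d s"
    using assms by (metis regular_cases)
  show ?thesis
    by (simp add: * rat_eval_Fract)
qed

lemma rat_eval_inverse: 
  assumes "s \<notin> rat_poles f" "rat_eval f s \<noteq> 0"
  shows "s \<notin> rat_poles (inverse f) \<and> rat_eval (inverse f) s = inverse (rat_eval f s)"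
proof -
  obtain a b where *: "f = Fraction_Field.Fract a b" "b \<noteq> 0" "poly b s \<noteq> 0" "rat_eval f s = poly a s / poly b s"
    using assms by (metis regular_cases)
  then have "a \<noteq> 0" using assms by auto
  then show ?thesis using * assms(2)
    by (simp add: rat_eval_Fract)
qed

lemma rat_eval_Fract_1: "s \<notin> rat_poles (Fraction_Field.Fract p 1) \<and> rat_eval (Fraction_Field.Fract p 1) s = poly p s"
  by (simp add: rat_eval_Fract)

lemma rat_eval_0_1: "s \<notin> rat_poles 0" "rat_eval 0 s = 0" "s \<notin> rat_poles 1" "rat_eval 1 s = 1"
  using rat_eval_Fract_1[of s 0]  rat_eval_Fract_1[of s 1] by (simp_all add: Zero_fract_def One_fract_def)

lemma rat_eval_minus: 
  assumes "s \<notin> rat_poles f"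
  shows "s \<notin> rat_poles (- f) \<and> rat_eval (- f) s = - rat_eval f s"
  using rat_eval_mult[OF conjunct1[OF rat_eval_Fract_1[of s "- 1"]] assms]
    conjunct2[OF rat_eval_Fract_1[of s "- 1"]]
  by (simp add: One_fract_def[symmetric] minus_fract[symmetric] del: minus_fract)

lemma rat_eval_diff: 
  assumes "s \<notin> rat_poles f" "s \<notin> rat_poles g"
  shows "s \<notin> rat_poles (f - g) \<and> rat_eval (f - g) s = rat_eval f s - rat_eval g s"
  using rat_eval_add[of s f "- g"] rat_eval_minus[of s g] assms by simp

lemma rat_poles_para: "s \<in> rat_poles (rat_para f) \<longleftrightarrow> - cnj s \<in> rat_poles f"
proof -
  have "s \<in> rat_poles (rat_para f) \<longleftrightarrow> poly (poly_para (rat_den f)) s = 0"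
    unfolding rat_para_def
    using rat_no_common_root[of f "- cnj s"]
    by (intro rat_eval_Fract(2)) (auto simp: poly_poly_para poly_para_nonzero rat_num_den)
  then show ?thesis by (simp add: poly_poly_para rat_poles_def)
qed

lemma rat_eval_sum:
  "(\<And>x. x \<in> A \<Longrightarrow> s \<notin> rat_poles (f x)) \<Longrightarrow> s \<notin> rat_poles (sum f A) \<and> rat_eval (sum f A) s = (\<Sum>x\<in>A. rat_eval (f x) s)"
  by (induction A rule: infinite_finite_induct) (simp_all add: rat_eval_0_1 rat_eval_add)

lemma finite_rat_poles: "finite (rat_poles f)"
  unfolding rat_poles_def by (rule poly_roots_finite) (simp add: rat_num_den)

lemma finite_axis_preimage: "finite S \<Longrightarrow> finite {\<omega>::real. \<i> * of_real \<omega> \<in> S}"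
  by (rule finite_subset[OF _ finite_vimageI[of S "\<lambda>\<omega>::real. \<i> * of_real \<omega>"]]) (auto simp: inj_def)

lemma cofinite_axis_not_trivial: "\<not> (\<forall>\<^sub>F t::real in cofinite. False)"
  by (simp add: eventually_cofinite infinite_UNIV_char_0)

lemma eventually_axis_regular: "\<forall>\<^sub>F \<omega>::real in cofinite. \<i> * of_real \<omega> \<notin> rat_poles f"
  unfolding eventually_cofinite using finite_axis_preimage[OF finite_rat_poles[of f]] by simp

lemma eventually_axis_nonzero: "f \<noteq> 0 \<Longrightarrow> \<forall>\<^sub>F \<omega>::real in cofinite. rat_eval f (\<i> * of_real \<omega>) \<noteq> 0"
proof -
  assume "f \<noteq> 0"
  then have "rat_num f * rat_den f \<noteq> 0" by (auto simp: rat_num_def rat_den_def)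
  from finite_axis_preimage[OF poly_roots_finite[OF this]]
  show ?thesis
    by (simp add: eventually_cofinite rat_eval_def disj_commute)
qed

section \<open>Spectral factorization of scalar functions\<close>

lemma nonneg_of_cofinite:
  fixes g :: "real \<Rightarrow> real"
  assumes "continuous_on UNIV g" "\<forall>\<^sub>F t in cofinite. 0 \<le> g t"
  shows "0 \<le> g t"
proof -
  let ?S = "{t. 0 \<le> g t}"
  have "finite (- ?S)"
    using assms(2) by (simp add: eventually_cofinite Compl_eq)
  then have "closure ?S = UNIV"
    using closure_complement[of "- ?S"] by (simp add: empty_interior_finite)
  moreover have "closed ?S"
    using assms(1) closed_Collect_le[of "\<lambda>_. 0" g] by simp
  ultimately show ?thesis
    using closure_closed by blast
qed

text \<open>On the axis \<open>r\<close> is real and does not change sign, while the linear factor \<open>s - \<i> t0\<close> does. So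
  \<open>r1(\<i> t)\<close> is purely imaginary with an imaginary part that changes sign at \<open>t0\<close>, and by continuity it
  vanishes there: roots on the axis have even multiplicity.\<close>

lemma double_root_on_axis:
  assumes para: "poly_para r = r" and nonneg: "\<And>t::real. 0 \<le> Re (poly r (\<i> * of_real t))"
    and fac: "r = [:- (\<i> * of_real t0), 1:] * r1"
  shows "poly r1 (\<i> * of_real t0) = 0"
proof -
  define h where "h t = poly r1 (\<i> * of_real t)" for t :: real
  have r: "poly r (\<i> * of_real t) = \<i> * of_real (t - t0) * h t" for t
    by (simp add: fac h_def algebra_simps)
  have real: "Im (poly r (\<i> * of_real t)) = 0" for t :: real
    using arg_cong[OF poly_poly_para[of r "\<i> * of_real t"], of Im] by (simp add: para)
  have cont: "continuous_on A (\<lambda>t. Im (h t))" "continuous_on A (\<lambda>t. Re (h t))" for A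
    unfolding h_def by (intro continuous_intros)+
  have sign: "(t - t0) * Im (h t) \<le> 0" for t
    using nonneg[of t] unfolding r by simp
  have "0 \<le> - Im (h t0)"
  proof (rule continuous_ge_on_closure[where S = "{t0<..}" and f = "\<lambda>t. - Im (h t)" and x = t0])
    show "0 \<le> - Im (h t)" if "t \<in> {t0<..}" for t
      using sign[of t] that by (simp add: mult_le_0_iff)
  qed (auto intro!: continuous_intros cont)
  moreover have "0 \<le> Im (h t0)"
  proof (rule continuous_ge_on_closure[where S = "{..<t0}" and f = "\<lambda>t. Im (h t)" and x = t0])
    show "0 \<le> Im (h t)" if "t \<in> {..<t0}" for t
      using sign[of t] that by (simp add: mult_le_0_iff)
  qed (auto intro!: continuous_intros cont)
  moreover have "0 \<le> - \<bar>Re (h t0)\<bar>"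
  proof (rule nonneg_of_cofinite[where g = "\<lambda>t. - \<bar>Re (h t)\<bar>" and t = t0])
    show "continuous_on UNIV (\<lambda>t. - \<bar>Re (h t)\<bar>)" 
      by (intro continuous_intros cont)
    have "Re (h t) = 0" if "t \<noteq> t0" for t
      using real[of t] that unfolding r by simp
    then show "\<forall>\<^sub>F t in cofinite. 0 \<le> - \<bar>Re (h t)\<bar>"
      by (auto simp: eventually_cofinite intro: finite_subset[of _ "{t0}"])
  qed
  ultimately show ?thesis
    by (simp add: h_def complex_eq_iff)
qed

text \<open>The roots of a self-conjugate polynomial are symmetric about the imaginary axis, and those on the
  axis are double. So with \<open>z\<close> the point \<open>- cnj z\<close> is also a root, and the factor
  \<open>(s - z) (- s - cnj z)\<close>, which equals \<open>\<bar>s - z\<bar>\<^sup>2\<close> on the axis, can be split off without losing the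
  hypotheses. Which root of a pair goes into
  \<open>q\<close> is arbitrary.\<close>

lemma poly_spectral_factor:
  assumes "poly_para r = r" "\<And>t::real. 0 \<le> Re (poly r (\<i> * of_real t))"
  shows "\<exists>q. r = q * poly_para q"
  using assms
proof (induction "degree r" arbitrary: r rule: less_induct)
  case less
  note para = less.prems(1) and nonneg = less.prems(2)
  show ?case
  proof (cases "degree r = 0")
    case True
    then obtain c where c: "r = [:c:]" by (rule degree_eq_zeroE)
    have "cnj c = c" using arg_cong[OF para, of "\<lambda>p. poly p 0"] by (simp add: poly_poly_para c)
    moreover have "0 \<le> Re c" using nonneg[of 0] by (simp add: c)
    ultimately have "c = of_real (sqrt (Re c)) * of_real (sqrt (Re c))"
      by (simp add: complex_eq_iff)
    then have "r = [:of_real (sqrt (Re c)):] * poly_para [:of_real (sqrt (Re c)):]"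
      by (intro poly_eqI_eval) (simp add: c poly_poly_para)
    then show ?thesis ..
  next
    case False
    then obtain z where z: "poly r z = 0"
      by (metis fundamental_theorem_of_algebra constant_degree)
    then obtain r1 where r1: "r = [:- z, 1:] * r1" by (metis poly_eq_0_iff_dvd dvdE)
    have "poly r1 (- cnj z) = 0"
    proof (cases "- cnj z = z")
      case True
      then have "z = \<i> * of_real (Im z)" by (simp add: complex_eq_iff)
      with True show ?thesis using double_root_on_axis[OF para nonneg, of "Im z" r1] r1 by simp
    next
      case False
      have "poly r (- cnj z) = 0"
        using poly_poly_para[of r "- cnj z"] z by (simp add: para)
      then have "(- cnj z - z) * poly r1 (- cnj z) = 0"
        by (simp add: r1 algebra_simps)
      with False show ?thesis by (simp only: mult_eq_0_iff right_minus_eq) simp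
    qed
    then obtain r2 where r2: "r1 = [:cnj z, 1:] * r2"
      by (metis poly_eq_0_iff_dvd dvdE minus_minus)
    define u where "u = [:- z, 1:]"
    have u: "poly_para u = - [:cnj z, 1:]" "u \<noteq> 0"
      by (intro poly_eqI_eval) (simp_all add: poly_poly_para u_def)
    define r3 where "r3 = - r2"
    have r: "r = (u * poly_para u) * r3"
      unfolding r1 r2 u(1) r3_def by (simp only: u_def mult_minus_left mult_minus_right minus_minus mult.assoc)
    have "poly_para r3 = r3"
    proof -
      have "(u * poly_para u) * poly_para r3 = (u * poly_para u) * r3"
        using para unfolding r poly_para_mult poly_para_para by (simp only: mult.commute)
      then show ?thesis using u(2) by (simp add: poly_para_nonzero)
    qed
    moreover have "0 \<le> Re (poly r3 (\<i> * of_real t))" for t :: real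
    proof (rule nonneg_of_cofinite[where g = "\<lambda>t. Re (poly r3 (\<i> * of_real t))" and t = t])
      show "continuous_on UNIV (\<lambda>t::real. Re (poly r3 (\<i> * of_real t)))"
        by (intro continuous_intros)
      have "0 \<le> Re (poly r3 (\<i> * of_real t))" if "t \<noteq> Im z" for t :: real
      proof -
        define w where "w = \<i> * of_real t - z"
        have w: "w \<noteq> 0" using that by (auto simp: w_def complex_eq_iff)
        have "poly r (\<i> * of_real t) = w * cnj w * poly r3 (\<i> * of_real t)"
          by (simp add: r poly_poly_para u_def w_def algebra_simps)
        also have "w * cnj w = of_real ((cmod w)\<^sup>2)" by (simp only: complex_norm_square)
        finally have "0 \<le> (cmod w)\<^sup>2 * Re (poly r3 (\<i> * of_real t))" using nonneg[of t] by simp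
        with w show ?thesis by (simp add: zero_le_mult_iff)
      qed
      then show "\<forall>\<^sub>F t::real in cofinite. 0 \<le> Re (poly r3 (\<i> * of_real t))"
        by (auto simp: eventually_cofinite intro: finite_subset[of _ "{Im z}"])
    qed
    moreover have "degree r3 < degree r"
    proof -
      have "r3 \<noteq> 0" using False r by auto
      then have "degree r = degree u + degree (poly_para u) + degree r3"
        using u(2) by (simp add: r degree_mult_eq poly_para_nonzero)
      then show ?thesis by (simp add: u_def)
    qed
    ultimately obtain q where "r3 = q * poly_para q" using less.hyps by blast
    then have "r = (u * q) * poly_para (u * q)"
      by (simp add: r poly_para_mult mult_ac)
    then show ?thesis ..
  qed
qed

text \<open>Multiplying numerator and denominator of \<open>f = p / q\<close> by the conjugate of \<open>q\<close> makes the denominator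
  \<open>\<bar>q\<bar>\<^sup>2\<close> on the axis, which leaves a polynomial problem for the numerator. The finitely many exceptional
  frequencies leave room for poles on the axis.\<close>

lemma rat_spectral_factor:
  assumes para: "rat_para f = f" and nonneg: "\<forall>\<^sub>F t::real in cofinite. 0 \<le> Re (rat_eval f (\<i> * of_real t))"
  shows "\<exists>g. f = g * rat_para g"
proof -
  define p q where "p = rat_num f" and "q = rat_den f"
  have f: "f = Fraction_Field.Fract p q" and q: "q \<noteq> 0"
    by (simp_all add: p_def q_def rat_num_den)
  define r where "r = p * poly_para q"
  have "poly_para p * q = r"
    using para q by (simp add: f rat_para_Fract eq_fract poly_para_nonzero r_def)
  then have "poly_para r = r"
    by (simp add: r_def poly_para_mult poly_para_para)
  moreover have "0 \<le> Re (poly r (\<i> * of_real t))" for t :: real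
  proof (rule nonneg_of_cofinite[where g = "\<lambda>t. Re (poly r (\<i> * of_real t))" and t = t])
    show "continuous_on UNIV (\<lambda>t::real. Re (poly r (\<i> * of_real t)))"
      by (intro continuous_intros)
    show "\<forall>\<^sub>F t::real in cofinite. 0 \<le> Re (poly r (\<i> * of_real t))"
      using nonneg
    proof eventually_elim
      case (elim t)
      let ?s = "\<i> * of_real t :: complex"
      have "poly r ?s = rat_eval f ?s * (poly q ?s * cnj (poly q ?s))"
        by (simp add: r_def poly_poly_para rat_eval_def p_def q_def)
      also have "\<dots> = rat_eval f ?s * of_real ((cmod (poly q ?s))\<^sup>2)"
        by (simp only: complex_norm_square)
      finally show ?case using elim by simp
    qed
  qed
  ultimately obtain s where s: "r = s * poly_para s" using poly_spectral_factor by blast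
  have "f = Fraction_Field.Fract r (q * poly_para q)"
    using q by (simp add: f r_def eq_fract poly_para_nonzero)
  also have "\<dots> = Fraction_Field.Fract s q * rat_para (Fraction_Field.Fract s q)"
    using q by (simp add: s rat_para_Fract)
  finally show ?thesis ..
qed

section \<open>Cancelling poles by all-pass functions\<close>

definition rhp_regular :: "rat_fun \<Rightarrow> bool" where
  "rhp_regular f \<longleftrightarrow> (\<forall>s. 0 < Re s \<longrightarrow> s \<notin> rat_poles f)"

lemma rhp_regular_mult: "rhp_regular f \<Longrightarrow> rhp_regular g \<Longrightarrow> rhp_regular (f * g)"
  by (simp add: rhp_regular_def rat_eval_mult)

lemma rhp_regular_FractI: "(\<And>s. 0 < Re s \<Longrightarrow> poly b s \<noteq> 0) \<Longrightarrow> rhp_regular (Fraction_Field.Fract a b)"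
  by (simp add: rhp_regular_def not_rat_polesI)

text \<open>Each root \<open>z\<close> of \<open>Q\<close> in the open right half-plane contributes the factor \<open>(s - z) / (s + cnj z)\<close>, which
  cancels the pole at \<open>z\<close>, has its own pole at \<open>- cnj z\<close> in the left half-plane, and has modulus one on
  the axis.\<close>

lemma blaschke_for_denominator:
  assumes "Q \<noteq> 0"
  shows "\<exists>b. b * rat_para b = 1 \<and> rhp_regular b \<and> rhp_regular (b * Fraction_Field.Fract 1 Q)"
  using assms
proof (induction "degree Q" arbitrary: Q rule: less_induct)
  case less
  show ?case
  proof (cases "degree Q = 0")
    case True
    then obtain c where "Q = [:c:]" by (rule degree_eq_zeroE)
    with less.prems show ?thesis
      by (intro exI[of _ 1]) (auto simp: rat_para_1 rhp_regular_def rat_eval_0_1 not_rat_polesI)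
  next
    case False
    then obtain z where "poly Q z = 0"
      by (metis fundamental_theorem_of_algebra constant_degree)
    then obtain Q' where Q': "Q = [:- z, 1:] * Q'" by (metis poly_eq_0_iff_dvd dvdE)
    then have "Q' \<noteq> 0" using less.prems by auto
    then have "degree Q' < degree Q" unfolding Q' by (subst degree_mult_eq) auto
    with \<open>Q' \<noteq> 0\<close> less.hyps obtain b where b: "b * rat_para b = 1" "rhp_regular b"
      "rhp_regular (b * Fraction_Field.Fract 1 Q')" by blast
    show ?thesis
    proof (cases "Re z \<le> 0")
      case True
      have "b * Fraction_Field.Fract 1 Q = b * Fraction_Field.Fract 1 Q' * Fraction_Field.Fract 1 [:- z, 1:]"
        by (simp add: Q' mult.assoc)
      moreover have "rhp_regular (Fraction_Field.Fract 1 [:- z, 1:])"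
        using True by (intro rhp_regular_FractI) (auto simp: complex_eq_iff)
      ultimately have "rhp_regular (b * Fraction_Field.Fract 1 Q)"
        using b(3) by (simp only: rhp_regular_mult)
      then show ?thesis using b(1,2) by blast
    next
      case z: False
      define c where "c = Fraction_Field.Fract [:- z, 1:] [:cnj z, 1:]"
      have para: "poly_para [:cnj z, 1:] = - [:- z, 1:]" "poly_para [:- z, 1:] = - [:cnj z, 1:]"
        by (rule poly_eqI_eval; simp add: poly_poly_para)+
      have c: "c * rat_para c = 1"
        by (simp add: c_def rat_para_Fract para One_fract_def eq_fract del: mult_pCons_left mult_pCons_right minus_pCons)
      have reg: "rhp_regular (Fraction_Field.Fract a [:cnj z, 1:])" for a
        using z by (intro rhp_regular_FractI) (auto simp: complex_eq_iff)
      have "b * c * Fraction_Field.Fract 1 Q = b * Fraction_Field.Fract 1 Q' * Fraction_Field.Fract 1 [:cnj z, 1:]"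
        using \<open>Q' \<noteq> 0\<close> by (simp add: Q' c_def mult.assoc eq_fract del: mult_pCons_left mult_pCons_right)
      then have "rhp_regular (b * c * Fraction_Field.Fract 1 Q)"
        using b(3) reg by (simp only: rhp_regular_mult)
      moreover have "(b * c) * rat_para (b * c) = 1"
        using b(1) c by (simp add: rat_para_mult mult_ac)
      moreover have "rhp_regular (b * c)"
        using b(2) reg unfolding c_def by (simp only: rhp_regular_mult)
      ultimately show ?thesis by blast
    qed
  qed
qed

lemma blaschke_for_finite_set:
  assumes "finite S"
  shows "\<exists>b. b * rat_para b = 1 \<and> rhp_regular b \<and> (\<forall>f\<in>S. rhp_regular (b * f))"
  using assms
proof induction
  case empty
  show ?case by (intro exI[of _ 1]) (simp add: rat_para_1 rhp_regular_def rat_eval_0_1)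
next
  case (insert f S)
  then obtain b where b: "b * rat_para b = 1" "rhp_regular b" "\<forall>f\<in>S. rhp_regular (b * f)" by blast
  obtain c where c: "c * rat_para c = 1" "rhp_regular c" "rhp_regular (c * Fraction_Field.Fract 1 (rat_den f))"
    using blaschke_for_denominator[OF rat_num_den(2)] by blast
  have "c * f = c * Fraction_Field.Fract 1 (rat_den f) * Fraction_Field.Fract (rat_num f) 1"
    by (simp only: mult.assoc mult_fract mult_1 mult_1_right rat_num_den(1))
  moreover have "rhp_regular (Fraction_Field.Fract (rat_num f) 1)"
    by (simp add: rhp_regular_def rat_eval_Fract_1)
  ultimately have "rhp_regular (c * f)"
    using c(3) by (simp only: rhp_regular_mult)
  have "rhp_regular (b * c * g)" if "g \<in> insert f S" for g
    using that b c rhp_regular_mult \<open>rhp_regular (c * f)\<close>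
    by (metis insertE mult.assoc mult.left_commute)
  moreover have "(b * c) * rat_para (b * c) = 1"
    using b(1) c(1) by (simp add: rat_para_mult mult_ac)
  ultimately show ?case
    using b c by (intro exI[of _ "b * c"]) (simp add: rhp_regular_mult)
qed

section \<open>Rational functions bounded by one on the imaginary axis\<close>

text \<open>Clearing the denominator turns the bound into one between continuous functions, which extends to the
  finitely many exceptional frequencies. It excludes poles on the axis and, by comparing growth at
  infinity, improper functions.\<close>

lemma axis_bounded_num_den:
  assumes "\<forall>\<^sub>F t::real in cofinite. cmod (rat_eval f (\<i> * of_real t)) \<le> 1"
  shows "cmod (poly (rat_num f) (\<i> * of_real t)) \<le> cmod (poly (rat_den f) (\<i> * of_real t))"
proof -
  have "0 \<le> cmod (poly (rat_den f) (\<i> * of_real t)) - cmod (poly (rat_num f) (\<i> * of_real t))"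
  proof (rule nonneg_of_cofinite[where g = "\<lambda>t. cmod (poly (rat_den f) (\<i> * of_real t)) - cmod (poly (rat_num f) (\<i> * of_real t))" and t = t])
    show "continuous_on UNIV (\<lambda>t. cmod (poly (rat_den f) (\<i> * of_real t)) - cmod (poly (rat_num f) (\<i> * of_real t)))"
      by (intro continuous_intros)
    show "\<forall>\<^sub>F t in cofinite. 0 \<le> cmod (poly (rat_den f) (\<i> * of_real t)) - cmod (poly (rat_num f) (\<i> * of_real t))"
      using assms eventually_axis_regular[of f]
      by eventually_elim (simp add: rat_eval_def rat_poles_def norm_divide field_simps)
  qed
  then show ?thesis by simp
qed

lemma axis_bounded_no_axis_pole:
  assumes "\<forall>\<^sub>F t::real in cofinite. cmod (rat_eval f (\<i> * of_real t)) \<le> 1" "Re s = 0"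
  shows "s \<notin> rat_poles f"
proof -
  have "s = \<i> * of_real (Im s)" using assms(2) by (simp add: complex_eq_iff)
  then show ?thesis
    using axis_bounded_num_den[OF assms(1), of "Im s"] rat_no_common_root[of f s]
    by (auto simp: rat_poles_def)
qed

lemma axis_bounded_proper:
  assumes "\<forall>\<^sub>F t::real in cofinite. cmod (rat_eval f (\<i> * of_real t)) \<le> 1"
  shows "rat_proper f"
proof (rule ccontr)
  assume "\<not> rat_proper f"
  then have deg: "degree (rat_den f) < degree (rat_num f)" by (simp add: rat_proper_def)
  have lim: "filterlim (\<lambda>t. \<i> * of_real t :: complex) at_infinity at_top"
    by (intro tendsto_mult_filterlim_at_infinity[OF tendsto_const] filterlim_of_real_at_infinity) simp
  have "((\<lambda>t. poly (rat_den f) (\<i> * of_real t) / poly (rat_num f) (\<i> * of_real t)) \<longlongrightarrow> 0) at_top"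
    using filterlim_compose[OF poly_divide_tendsto_0_at_infinity[OF deg] lim] .
  then have "\<forall>\<^sub>F t in at_top. cmod (poly (rat_den f) (\<i> * of_real t) / poly (rat_num f) (\<i> * of_real t)) < 1"
    by (auto dest: tendstoD[where e = 1])
  moreover have "filterlim (\<lambda>t. poly (rat_num f) (\<i> * of_real t)) at_infinity at_top"
    using deg by (intro filterlim_compose[OF filterlim_poly_at_infinity lim]) auto
  then have "\<forall>\<^sub>F t in at_top. poly (rat_num f) (\<i> * of_real t) \<noteq> 0"
    by (rule filterlim_at_infinity_imp_eventually_ne)
  ultimately have "\<forall>\<^sub>F t::real in at_top. False"
  proof eventually_elim
    case (elim t)
    then show False using axis_bounded_num_den[OF assms, of t] by (simp add: norm_divide field_simps)
  qed
  then show False by simp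
qed

lemma rat_eval_holomorphic: "(\<And>s. s \<in> A \<Longrightarrow> s \<notin> rat_poles f) \<Longrightarrow> rat_eval f holomorphic_on A"
  unfolding rat_eval_def[abs_def] rat_poles_def by (intro holomorphic_intros) auto

lemma stable_proper_bounded:
  assumes reg: "\<And>s. 0 \<le> Re s \<Longrightarrow> s \<notin> rat_poles f" and "rat_proper f"
  shows "bounded (rat_eval f ` {s. 0 < Re s})"
proof -
  define p q where "p = rat_num f" and "q = rat_den f"
  have q: "q \<noteq> 0" by (simp add: q_def rat_num_den)
  have deg: "degree p \<le> degree q" using assms by (simp add: p_def q_def rat_proper_def)
  obtain L where "((\<lambda>s. poly p s / poly q s) \<longlongrightarrow> L) at_infinity"
  proof (cases "degree p = degree q")
    case True
    have "((\<lambda>s. (poly p s / s ^ degree p) / (poly q s / s ^ degree q)) \<longlongrightarrow> lead_coeff p / lead_coeff q) at_infinity"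
      using q by (intro tendsto_divide poly_divide_tendsto_aux) auto
    moreover have "\<forall>\<^sub>F s::complex in at_infinity. (poly p s / s ^ degree p) / (poly q s / s ^ degree q) = poly p s / poly q s"
      by (rule eventually_at_infinityI[of 1]) (auto simp: True divide_simps)
    ultimately have "((\<lambda>s. poly p s / poly q s) \<longlongrightarrow> lead_coeff p / lead_coeff q) at_infinity"
      by (rule Lim_transform_eventually)
    then show ?thesis by (rule that)
  next
    case False
    then show ?thesis using deg by (intro that[of 0] poly_divide_tendsto_0_at_infinity) simp
  qed
  then have "\<forall>\<^sub>F s in at_infinity. dist (rat_eval f s) L < 1"
    by (auto simp: rat_eval_def p_def q_def dest: tendstoD[where e = 1])
  then obtain R where R: "\<And>s. R \<le> norm s \<Longrightarrow> dist (rat_eval f s) L < 1"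
    by (auto simp: eventually_at_infinity)
  let ?C = "cball 0 R \<inter> {s. 0 \<le> Re s}"
  have "compact ?C"
    by (intro compact_Int_closed compact_cball closed_halfspace_Re_ge)
  moreover have "continuous_on ?C (rat_eval f)"
    by (intro holomorphic_on_imp_continuous_on rat_eval_holomorphic reg) auto
  ultimately have "bounded (rat_eval f ` ?C)"
    by (intro compact_imp_bounded compact_continuous_image)
  then have "bounded (rat_eval f ` ?C \<union> ball L 1)" by simp
  then show ?thesis
  proof (rule bounded_subset, intro image_subsetI)
    fix s assume "s \<in> {s. 0 < Re s}"
    then show "rat_eval f s \<in> rat_eval f ` ?C \<union> ball L 1"
      using R[of s] by (cases "norm s \<le> R") (auto simp: dist_commute)
  qed
qed

text \<open>Being bounded by one on the axis excludes every pole there and at infinity. Once there are no poles in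
  the open right half-plane either, the finitely many poles keep a positive distance from the closed
  one, and boundedness follows by compactness.\<close>

lemma stable_hardy_of_axis_bounded:
  assumes "\<And>f. f \<in> elements_mat X \<Longrightarrow> rhp_regular f"
    "\<And>f. f \<in> elements_mat X \<Longrightarrow> \<forall>\<^sub>F t::real in cofinite. cmod (rat_eval f (\<i> * of_real t)) \<le> 1"
  shows "stable_rat X" "hardy_inf X"
proof -
  have reg: "s \<notin> rat_poles f" if "f \<in> elements_mat X" "0 \<le> Re s" for f s
    using assms(1)[OF that(1)] axis_bounded_no_axis_pole[OF assms(2)[OF that(1)], of s] that(2)
    by (cases "Re s = 0") (auto simp: rhp_regular_def)
  have "elements_mat X = (\<lambda>(i,j). X $$ (i,j)) ` ({..<dim_row X} \<times> {..<dim_col X})"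
    by (auto simp: elements_mat_def)
  then have "finite (\<Union>f\<in>elements_mat X. Re ` rat_poles f)" (is "finite ?P")
    by (simp add: finite_rat_poles)
  moreover have neg: "x < 0" if "x \<in> ?P" for x
    using that reg by (force simp: not_le[symmetric])
  \<comment> \<open>the largest real part of a pole is negative; without poles any positive number will do\<close>
  ultimately obtain \<tau> where \<tau>: "\<tau> > 0" "\<And>x. x \<in> ?P \<Longrightarrow> x \<le> - \<tau>"
  proof (cases "?P = {}")
    case False
    then show ?thesis
      using neg[OF Max_in[OF \<open>finite ?P\<close> False]] Max_ge[OF \<open>finite ?P\<close>]
      by (intro that[of "- Max ?P"]) (simp_all only: neg_less_0_iff_less minus_minus)
  qed (use that[of 1] in auto)
  have "rat_eval f holomorphic_on {s. Re s > - \<tau>}" if "f \<in> elements_mat X" for f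
    using \<tau>(2) that by (intro rat_eval_holomorphic) force
  with \<tau>(1) reg show "stable_rat X"
    unfolding stable_rat_def by (auto simp: not_le[symmetric])
  show "hardy_inf X"
    unfolding hardy_inf_def
    using reg assms(2) by (auto intro!: rat_eval_holomorphic stable_proper_bounded axis_bounded_proper)
qed

section \<open>Para-adjoints and values of rational matrices\<close>

lemma dim_mat_adjoint [simp]: "dim_row (mat_adjoint A) = dim_col A" "dim_col (mat_adjoint A) = dim_row A"
  by (simp_all add: mat_adjoint_def)

lemma index_mat_adjoint [simp]:
  "i < dim_col A \<Longrightarrow> j < dim_row A \<Longrightarrow> mat_adjoint (A :: complex mat) $$ (i, j) = cnj (A $$ (j, i))"
  by (simp add: mat_adjoint_def mat_of_rows_def)

lemma dim_para_adjoint [simp]: "dim_row (para_adjoint A) = dim_col A" "dim_col (para_adjoint A) = dim_row A"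
  by (simp_all add: para_adjoint_def)

lemma para_adjoint_carrier: "A \<in> carrier_mat n p \<Longrightarrow> para_adjoint A \<in> carrier_mat p n"
  by auto

lemma index_para_adjoint [simp]:
  "i < dim_col A \<Longrightarrow> j < dim_row A \<Longrightarrow> para_adjoint A $$ (i, j) = rat_para (A $$ (j, i))"
  by (simp add: para_adjoint_def)

lemma index_mult_mat_sum:
  "i < dim_row A \<Longrightarrow> j < dim_col B \<Longrightarrow> dim_col A = dim_row B \<Longrightarrow> 
   (A * B) $$ (i, j) = (\<Sum>k<dim_row B. A $$ (i, k) * B $$ (k, j))"
  by (simp add: scalar_prod_def lessThan_atLeast0)

lemma para_adjoint_para_adjoint: "para_adjoint (para_adjoint A) = A"
  by (rule eq_matI) (simp_all add: rat_para_para)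

lemma para_adjoint_mult:
  "A \<in> carrier_mat n k \<Longrightarrow> B \<in> carrier_mat k p \<Longrightarrow> para_adjoint (A * B) = para_adjoint B * para_adjoint A"
  by (rule eq_matI) (auto simp: index_mult_mat_sum rat_para_sum rat_para_mult mult.commute simp del: index_mult_mat(1))

lemma para_adjoint_uminus: "para_adjoint (- A) = - para_adjoint A"
  by (rule eq_matI) (simp_all add: rat_para_minus)

lemma para_adjoint_minus:
  "A \<in> carrier_mat n k \<Longrightarrow> B \<in> carrier_mat n k \<Longrightarrow> para_adjoint (A - B) = para_adjoint A - para_adjoint B"
  by (rule eq_matI) (auto simp: rat_para_diff)

lemma para_adjoint_add:
  "A \<in> carrier_mat n k \<Longrightarrow> B \<in> carrier_mat n k \<Longrightarrow> para_adjoint (A + B) = para_adjoint A + para_adjoint B"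
  by (rule eq_matI) (auto simp: rat_para_add)

lemma para_adjoint_one: "para_adjoint (1\<^sub>m n) = 1\<^sub>m n"
  by (rule eq_matI) (auto simp: rat_para_1 rat_para_0)

definition regular_mat :: "rat_mat \<Rightarrow> complex \<Rightarrow> bool" where
  "regular_mat X s \<longleftrightarrow> (\<forall>f\<in>elements_mat X. s \<notin> rat_poles f)"

lemma regular_mat_index: "regular_mat X s \<longleftrightarrow> (\<forall>i<dim_row X. \<forall>j<dim_col X. s \<notin> rat_poles (X $$ (i, j)))"
  by (auto simp: regular_mat_def elements_mat_def)

lemma eventually_regular_mat: "\<forall>\<^sub>F t::real in cofinite. regular_mat X (\<i> * of_real t)"
proof -
  have "finite (elements_mat X)" by (simp add: elements_mat_def)
  then show ?thesis
    unfolding regular_mat_def by (simp add: eventually_ball_finite eventually_axis_regular)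
qed

lemma regular_mat_para_adjoint_axis: "regular_mat (para_adjoint X) (\<i> * of_real t) \<longleftrightarrow> regular_mat X (\<i> * of_real t)"
  by (auto simp: regular_mat_index rat_poles_para)

lemma eval_mat_para_adjoint_axis: "eval_mat (para_adjoint X) (\<i> * of_real t) = mat_adjoint (eval_mat X (\<i> * of_real t))"
  by (simp add: eval_mat_para_adjoint)

lemma eval_mat_mult:
  assumes "regular_mat X s" "regular_mat Y s" "dim_col X = dim_row Y"
  shows "eval_mat (X * Y) s = eval_mat X s * eval_mat Y s"
proof (rule eq_matI)
  fix i j assume ij: "i < dim_row (eval_mat X s * eval_mat Y s)" "j < dim_col (eval_mat X s * eval_mat Y s)"
  then have "rat_eval (\<Sum>k<dim_row Y. X $$ (i, k) * Y $$ (k, j)) s = (\<Sum>k<dim_row Y. rat_eval (X $$ (i, k) * Y $$ (k, j)) s)"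
    using assms by (intro conjunct2[OF rat_eval_sum] conjunct1[OF rat_eval_mult]) (auto simp: regular_mat_index)
  also have "\<dots> = (\<Sum>k<dim_row Y. rat_eval (X $$ (i, k)) s * rat_eval (Y $$ (k, j)) s)"
    using assms ij by (intro sum.cong conjunct2[OF rat_eval_mult]) (auto simp: regular_mat_index)
  finally show "eval_mat (X * Y) s $$ (i, j) = (eval_mat X s * eval_mat Y s) $$ (i, j)"
    using ij assms(3) by (simp add: index_mult_mat_sum del: index_mult_mat(1))
qed auto

lemma regular_mat_mult:
  assumes "regular_mat X s" "regular_mat Y s" "dim_col X = dim_row Y"
  shows "regular_mat (X * Y) s"
  using assms unfolding regular_mat_index
  by (auto simp: index_mult_mat_sum rat_eval_mult simp del: index_mult_mat(1) intro!: conjunct1[OF rat_eval_sum])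

lemma eval_mat_minus:
  assumes "regular_mat X s" "regular_mat Y s" "X \<in> carrier_mat n p" "Y \<in> carrier_mat n p"
  shows "eval_mat (X - Y) s = eval_mat X s - eval_mat Y s"
  using assms by (intro eq_matI) (auto simp: regular_mat_index rat_eval_diff)

lemma regular_mat_one: "regular_mat (1\<^sub>m n) s"
  by (auto simp: regular_mat_index rat_eval_0_1)

lemma eval_mat_one: "eval_mat (1\<^sub>m n) s = 1\<^sub>m n"
  by (rule eq_matI) (auto simp: rat_eval_0_1)

lemma eval_gram_defect:
  assumes "regular_mat X (\<i> * of_real t)" "X \<in> carrier_mat n p"
  shows "eval_mat (1\<^sub>m n - X * para_adjoint X) (\<i> * of_real t)
    = 1\<^sub>m n - eval_mat X (\<i> * of_real t) * mat_adjoint (eval_mat X (\<i> * of_real t))"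
  using assms
  by (subst eval_mat_minus[of _ _ _ n n])
    (auto simp: regular_mat_one regular_mat_mult regular_mat_para_adjoint_axis eval_mat_mult eval_mat_one eval_mat_para_adjoint_axis)

lemma eval_gram_defect_swap:
  assumes "regular_mat K (\<i> * of_real t)" "K \<in> carrier_mat n p"
  shows "eval_mat (1\<^sub>m p - para_adjoint K * K) (\<i> * of_real t)
    = 1\<^sub>m p - mat_adjoint (eval_mat K (\<i> * of_real t)) * eval_mat K (\<i> * of_real t)"
  using assms
  by (subst eval_mat_minus[of _ _ _ p p])
    (auto simp: regular_mat_one regular_mat_mult regular_mat_para_adjoint_axis eval_mat_mult eval_mat_one eval_mat_para_adjoint_axis)

section \<open>Positive definite matrices\<close>

lemma cinner_sum: "v \<bullet>c w = (\<Sum>i<dim_vec w. vec_index v i * cnj (vec_index w i))"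
  by (simp add: scalar_prod_def lessThan_atLeast0)

lemma index_mult_mat_vec_sum:
  "i < dim_row A \<Longrightarrow> vec_index (A *\<^sub>v v) i = (\<Sum>j<dim_vec v. A $$ (i, j) * vec_index v j)"
  if "dim_col A = dim_vec v"
  using that by (simp add: scalar_prod_def lessThan_atLeast0)

lemma adjoint_cinner:
  fixes K :: "complex mat"
  assumes "K \<in> carrier_mat n p" "u \<in> carrier_vec n" "v \<in> carrier_vec p"
  shows "(mat_adjoint K *\<^sub>v u) \<bullet>c v = u \<bullet>c (K *\<^sub>v v)"
proof -
  have "(mat_adjoint K *\<^sub>v u) \<bullet>c v = (\<Sum>j<p. \<Sum>i<n. cnj (K $$ (i, j)) * vec_index u i * cnj (vec_index v j))"
    using assms by (simp add: cinner_sum index_mult_mat_vec_sum sum_distrib_right del: index_mult_mat_vec)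
  also have "\<dots> = (\<Sum>i<n. \<Sum>j<p. cnj (K $$ (i, j)) * vec_index u i * cnj (vec_index v j))"
    by (rule sum.swap)
  also have "\<dots> = u \<bullet>c (K *\<^sub>v v)"
    using assms by (simp add: cinner_sum index_mult_mat_vec_sum sum_distrib_left mult_ac del: index_mult_mat_vec)
  finally show ?thesis .
qed

lemma cinner_self_nonneg: "0 \<le> Re (v \<bullet>c v)"
  unfolding cinner_sum Re_sum by (rule sum_nonneg) simp

lemma cinner_self_pos: "v \<noteq> 0\<^sub>v n \<Longrightarrow> v \<in> carrier_vec n \<Longrightarrow> 0 < Re (v \<bullet>c v)"
proof -
  assume "v \<noteq> 0\<^sub>v n" "v \<in> carrier_vec n"
  then obtain i where "i < n" "vec_index v i \<noteq> 0" by (auto simp: vec_eq_iff)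
  moreover have "0 < Re (vec_index v i * cnj (vec_index v i))" if "vec_index v i \<noteq> 0"
    using that by (simp add: complex_eq_iff sum_power2_gt_zero_iff flip: power2_eq_square)
  ultimately show ?thesis
    using \<open>v \<in> carrier_vec n\<close> unfolding cinner_sum Re_sum
    by (intro sum_pos2[of _ i]) auto
qed

lemma cinner_commute:
  fixes v w :: "complex vec"
  assumes "v \<in> carrier_vec n" "w \<in> carrier_vec n"
  shows "v \<bullet>c w = cnj (w \<bullet>c v)"
  using assms by (simp add: cinner_sum mult.commute)

lemma cinner_minus_self:
  fixes v w :: "complex vec"
  assumes "v \<in> carrier_vec n" "w \<in> carrier_vec n"
  shows "(v - w) \<bullet>c (v - w) = v \<bullet>c v - v \<bullet>c w - w \<bullet>c v + w \<bullet>c w"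
  using assms by (simp add: cinner_sum sum.distrib[symmetric] sum_subtractf[symmetric] algebra_simps)

lemma mat_adjoint_gram_defect:
  fixes K :: "complex mat"
  assumes "K \<in> carrier_mat n p"
  shows "mat_adjoint (1\<^sub>m n - K * mat_adjoint K) = 1\<^sub>m n - K * mat_adjoint K"
  using assms
  by (intro eq_matI) (auto simp: index_mult_mat_sum mult.commute simp del: index_mult_mat(1))

text \<open>Put \<open>u = K v\<close>. The hypothesis gives \<open>\<bar>K\<^sup>\<dagger> u\<bar>\<^sup>2 < \<bar>u\<bar>\<^sup>2\<close> when \<open>u\<close> is nonzero, and expanding
  \<open>0 \<le> \<bar>v - K\<^sup>\<dagger> u\<bar>\<^sup>2 = \<bar>v\<bar>\<^sup>2 - 2 \<bar>u\<bar>\<^sup>2 + \<bar>K\<^sup>\<dagger> u\<bar>\<^sup>2\<close> yields \<open>\<bar>u\<bar>\<^sup>2 < \<bar>v\<bar>\<^sup>2\<close>.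
  When \<open>u\<close> is zero this only says that \<open>v\<close> is not.\<close>

lemma pos_def_gram_defect_swap:
  assumes K: "K \<in> carrier_mat n p" and pd: "pos_def (1\<^sub>m n - K * mat_adjoint K)"
  shows "pos_def (1\<^sub>m p - mat_adjoint K * K)"
proof -
  let ?L = "mat_adjoint K"
  have L: "?L \<in> carrier_mat p n" using K by auto
  have LL: "mat_adjoint ?L = K" using K by (intro eq_matI) auto
  have pd': "0 < Re (u \<bullet>c u) - Re ((?L *\<^sub>v u) \<bullet>c (?L *\<^sub>v u))" if u: "u \<in> carrier_vec n" "u \<noteq> 0\<^sub>v n" for u
  proof -
    have "((1\<^sub>m n - K * ?L) *\<^sub>v u) \<bullet>c u = u \<bullet>c u - (K *\<^sub>v (?L *\<^sub>v u)) \<bullet>c u"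
      using K L u by (simp add: minus_mult_distrib_mat_vec[of _ n n] minus_scalar_prod_distrib[of _ n])
    also have "(K *\<^sub>v (?L *\<^sub>v u)) \<bullet>c u = (?L *\<^sub>v u) \<bullet>c (?L *\<^sub>v u)"
      using adjoint_cinner[OF L mult_mat_vec_carrier[OF L u(1)] u(1)] by (simp add: LL)
    finally show ?thesis using pd u K by (auto simp: pos_def_def)
  qed
  show ?thesis unfolding pos_def_def
  proof (intro conjI ballI impI)
    show "mat_adjoint (1\<^sub>m p - ?L * K) = 1\<^sub>m p - ?L * K"
      using mat_adjoint_gram_defect[OF L] by (simp add: LL)
    fix v :: "complex vec"
    assume "v \<in> carrier_vec (dim_row (1\<^sub>m p - ?L * K))" "v \<noteq> 0\<^sub>v (dim_row (1\<^sub>m p - ?L * K))"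
    then have v: "v \<in> carrier_vec p" "v \<noteq> 0\<^sub>v p" using K by auto
    define u where "u = K *\<^sub>v v"
    have u: "u \<in> carrier_vec n" using K v by (auto simp: u_def)
    have Lu: "?L *\<^sub>v u \<in> carrier_vec p" using L u by auto
    have 1: "(?L *\<^sub>v u) \<bullet>c v = u \<bullet>c u"
      using adjoint_cinner[OF K u v(1)] by (simp add: u_def)
    have "((1\<^sub>m p - ?L * K) *\<^sub>v v) \<bullet>c v = v \<bullet>c v - (?L *\<^sub>v u) \<bullet>c v"
      using K L v by (simp add: u_def minus_mult_distrib_mat_vec[of _ p p] minus_scalar_prod_distrib[of _ p])
    then have goal: "Re (((1\<^sub>m p - ?L * K) *\<^sub>v v) \<bullet>c v) = Re (v \<bullet>c v) - Re (u \<bullet>c u)" by (simp add: 1)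
    show "0 < Re (((1\<^sub>m p - ?L * K) *\<^sub>v v) \<bullet>c v)"
    proof (cases "u = 0\<^sub>v n")
      case True
      then have "u \<bullet>c u = 0" by (simp add: cinner_sum)
      with goal cinner_self_pos[OF v(2,1)] show ?thesis by simp
    next
      case False
      define w where "w = v - ?L *\<^sub>v u"
      have "v \<bullet>c (?L *\<^sub>v u) = cnj ((?L *\<^sub>v u) \<bullet>c v)"
        using v(1) Lu by (rule cinner_commute)
      then have 2: "Re (v \<bullet>c (?L *\<^sub>v u)) = Re (u \<bullet>c u)" by (simp add: 1)
      have "Re (w \<bullet>c w) = Re (v \<bullet>c v) - Re (v \<bullet>c (?L *\<^sub>v u)) - Re ((?L *\<^sub>v u) \<bullet>c v) + Re ((?L *\<^sub>v u) \<bullet>c (?L *\<^sub>v u))"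
        using cinner_minus_self[OF v(1) Lu] by (simp add: w_def)
      then have "0 \<le> Re (v \<bullet>c v) - 2 * Re (u \<bullet>c u) + Re ((?L *\<^sub>v u) \<bullet>c (?L *\<^sub>v u))"
        using cinner_self_nonneg[of w] by (simp add: 1 2)
      with pd'[OF u False] goal show ?thesis by simp
    qed
  qed (use K in auto)
qed

lemma pos_def_det_nonzero:
  assumes M: "M \<in> carrier_mat n n" and pd: "pos_def M"
  shows "det M \<noteq> 0"
proof
  assume "det M = 0"
  then obtain v where "v \<in> carrier_vec n" "v \<noteq> 0\<^sub>v n" "M *\<^sub>v v = 0\<^sub>v n"
    using det_0_iff_vec_prod_zero_field[OF M] by blast
  moreover from this have "0 < Re ((M *\<^sub>v v) \<bullet>c v)"
    using pd M by (auto simp: pos_def_def)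
  ultimately show False by (simp add: cinner_sum)
qed

text \<open>The complement of the \<open>(0, 0)\<close> entry. It is defined over any field, so that the same operation applies
  to rational matrices and to their values.\<close>

definition schur_complement :: "'a::field mat \<Rightarrow> 'a mat" where
  "schur_complement M = mat (dim_row M - 1) (dim_col M - 1)
     (\<lambda>(i, j). M $$ (Suc i, Suc j) - M $$ (Suc i, 0) * M $$ (0, Suc j) / M $$ (0, 0))"

text \<open>The quadratic form of the Schur complement at \<open>v\<close> is that of \<open>M\<close> at the extension of \<open>v\<close> by the first
  coordinate that makes the first entry of \<open>M w\<close> vanish.\<close>

lemma pos_def_schur_complement:
  assumes M: "M \<in> carrier_mat (Suc n) (Suc n)" and pd: "pos_def M"
  shows "0 < Re (M $$ (0, 0))" and "pos_def (schur_complement M)"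
proof -
  have herm: "cnj (M $$ (i, j)) = M $$ (j, i)" if "i < Suc n" "j < Suc n" for i j
    using arg_cong[of _ _ "\<lambda>A. A $$ (j, i)", OF conjunct1[OF conjunct2[OF pd[unfolded pos_def_def]]]] M that by simp
  have quad: "0 < Re ((M *\<^sub>v v) \<bullet>c v)" if "v \<in> carrier_vec (Suc n)" "v \<noteq> 0\<^sub>v (Suc n)" for v
    using pd M that by (auto simp: pos_def_def)
  have "unit_vec (Suc n) 0 \<noteq> (0\<^sub>v (Suc n) :: complex vec)"
    by (auto simp: vec_eq_iff)
  from quad[OF _ this] show a: "0 < Re (M $$ (0, 0))"
    using M by (simp add: cinner_sum index_mult_mat_vec_sum unit_vec_def sum.lessThan_Suc_shift del: index_mult_mat_vec sum.lessThan_Suc)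
  define S where "S = schur_complement M"
  have S: "S \<in> carrier_mat n n" 
    and S_index: "\<And>i j. i < n \<Longrightarrow> j < n \<Longrightarrow> S $$ (i, j) = M $$ (Suc i, Suc j) - M $$ (Suc i, 0) * M $$ (0, Suc j) / M $$ (0, 0)"
    using M by (auto simp: S_def schur_complement_def)
  have "mat_adjoint S = S"
    using S by (intro eq_matI) (auto simp: S_index herm)
  moreover have "0 < Re ((S *\<^sub>v v) \<bullet>c v)" if v: "v \<in> carrier_vec n" "v \<noteq> 0\<^sub>v n" for v
  proof -
    define c where "c = - (\<Sum>j<n. M $$ (0, Suc j) * vec_index v j) / M $$ (0, 0)"
    define w where "w = vec (Suc n) (case_nat c (vec_index v))"
    have w: "w \<in> carrier_vec (Suc n)" "vec_index w 0 = c" "\<And>i. i < n \<Longrightarrow> vec_index w (Suc i) = vec_index v i"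
      by (simp_all add: w_def)
    have "w \<noteq> 0\<^sub>v (Suc n)" using v w by (auto simp: vec_eq_iff)
    have 0: "vec_index (M *\<^sub>v w) 0 = 0"
      using M w a by (auto simp: index_mult_mat_vec_sum sum.lessThan_Suc_shift c_def simp del: index_mult_mat_vec sum.lessThan_Suc)
    have Suc: "vec_index (M *\<^sub>v w) (Suc i) = vec_index (S *\<^sub>v v) i" if "i < n" for i
    proof -
      have "vec_index (M *\<^sub>v w) (Suc i) = M $$ (Suc i, 0) * c + (\<Sum>j<n. M $$ (Suc i, Suc j) * vec_index v j)"
        using M w that by (simp add: index_mult_mat_vec_sum sum.lessThan_Suc_shift del: index_mult_mat_vec sum.lessThan_Suc)
      also have "M $$ (Suc i, 0) * c = (\<Sum>j<n. - (M $$ (Suc i, 0) * M $$ (0, Suc j) / M $$ (0, 0)) * vec_index v j)"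
        by (simp add: c_def sum_negf sum_distrib_left sum_divide_distrib mult.assoc)
      also have "\<dots> + (\<Sum>j<n. M $$ (Suc i, Suc j) * vec_index v j) = (\<Sum>j<n. S $$ (i, j) * vec_index v j)"
        using that by (simp add: S_index sum.distrib[symmetric] algebra_simps)
      also have "\<dots> = vec_index (S *\<^sub>v v) i"
        using that S v by (simp add: index_mult_mat_vec_sum del: index_mult_mat_vec)
      finally show ?thesis .
    qed
    have "(M *\<^sub>v w) \<bullet>c w = (S *\<^sub>v v) \<bullet>c v"
      using v w S M by (simp add: cinner_sum sum.lessThan_Suc_shift 0 Suc del: index_mult_mat_vec sum.lessThan_Suc)
    with quad[OF w(1) \<open>w \<noteq> _\<close>] show ?thesis by simp
  qed
  ultimately show "pos_def (schur_complement M)"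
    using S by (auto simp: pos_def_def S_def[symmetric])
qed

lemma eval_schur_complement:
  assumes Z: "Z \<in> carrier_mat (Suc n) (Suc n)" and reg: "regular_mat Z s" and nz: "rat_eval (Z $$ (0, 0)) s \<noteq> 0"
  shows "eval_mat (schur_complement Z) s = schur_complement (eval_mat Z s)"
proof (rule eq_matI)
  fix i j assume "i < dim_row (schur_complement (eval_mat Z s))" "j < dim_col (schur_complement (eval_mat Z s))"
  then have ij: "i < n" "j < n" using Z by (auto simp: schur_complement_def)
  then have reg': "s \<notin> rat_poles (Z $$ (Suc i, Suc j))" "s \<notin> rat_poles (Z $$ (Suc i, 0))"
    "s \<notin> rat_poles (Z $$ (0, Suc j))" "s \<notin> rat_poles (Z $$ (0, 0))"
    using Z reg by (auto simp: regular_mat_index)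
  note inv = rat_eval_inverse[OF reg'(4) nz]
  note mult1 = rat_eval_mult[OF reg'(2,3)]
  note mult2 = rat_eval_mult[OF conjunct1[OF mult1] conjunct1[OF inv]]
  show "eval_mat (schur_complement Z) s $$ (i, j) = schur_complement (eval_mat Z s) $$ (i, j)"
    using ij Z rat_eval_diff[OF reg'(1) conjunct1[OF mult2]] mult1 mult2 inv
    by (simp add: schur_complement_def divide_inverse)
qed (auto simp: schur_complement_def)

section \<open>Spectral factorization of rational matrices\<close>

text \<open>A Cholesky decomposition over the field of rational functions with the involution \<open>rat_para\<close>. It goes through because a
  pivot, being positive at almost every point of the axis, has the form \<open>g g\<^sup>H\<close>; then \<open>g\<close> starts the first column of the factor, and the Schur complement is again positive
  definite at all but finitely many frequencies. Nothing keeps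
  the poles of \<open>F\<close> out of the right half-plane.\<close>

lemma mat_spectral_factor:
  assumes "Z \<in> carrier_mat n n" "para_adjoint Z = Z"
    "\<forall>\<^sub>F t::real in cofinite. pos_def (eval_mat Z (\<i> * of_real t))"
  shows "\<exists>F\<in>carrier_mat n n. Z = F * para_adjoint F"
  using assms
proof (induction n arbitrary: Z)
  case 0
  then show ?case by (intro bexI[of _ "0\<^sub>m 0 0"]) auto
next
  case (Suc n)
  note Z = Suc.prems(1)
  have para: "rat_para (Z $$ (i, j)) = Z $$ (j, i)" if "i < Suc n" "j < Suc n" for i j
    using arg_cong[OF Suc.prems(2), of "\<lambda>A. A $$ (j, i)"] Z that by simp
  define a where "a = Z $$ (0, 0)"
  have pd: "\<forall>\<^sub>F t::real in cofinite. 0 < Re (rat_eval a (\<i> * of_real t)) \<and> pos_def (schur_complement (eval_mat Z (\<i> * of_real t)))"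
    using Suc.prems(3)
  proof eventually_elim
    case (elim t)
    show ?case
      using pos_def_schur_complement[of "eval_mat Z (\<i> * of_real t)" n] elim Z by (simp add: a_def)
  qed
  then have "\<forall>\<^sub>F t::real in cofinite. 0 \<le> Re (rat_eval a (\<i> * of_real t))"
    by eventually_elim simp
  then obtain g where g: "a = g * rat_para g"
    using rat_spectral_factor[of a] para by (auto simp: a_def)
  have "a \<noteq> 0"
  proof
    assume "a = 0"
    with pd have "\<forall>\<^sub>F t::real in cofinite. False" by (simp add: rat_eval_0_1)
    then show False using cofinite_axis_not_trivial by blast
  qed
  then have g0: "g \<noteq> 0" "rat_para g \<noteq> 0" using g by auto
  define S where "S = schur_complement Z"
  have S: "S \<in> carrier_mat n n"
    and S_index: "\<And>i j. i < n \<Longrightarrow> j < n \<Longrightarrow> S $$ (i, j) = Z $$ (Suc i, Suc j) - Z $$ (Suc i, 0) * Z $$ (0, Suc j) / a"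
    using Z by (auto simp: S_def schur_complement_def a_def)
  have "para_adjoint S = S"
    using S para by (intro eq_matI) (auto simp: S_index rat_para_diff rat_para_mult divide_inverse rat_para_inverse a_def mult_ac)
  moreover have "\<forall>\<^sub>F t::real in cofinite. pos_def (eval_mat S (\<i> * of_real t))"
    using pd eventually_regular_mat[of Z]
  proof eventually_elim
    case (elim t)
    then have "rat_eval (Z $$ (0, 0)) (\<i> * of_real t) \<noteq> 0" by (auto simp: a_def)
    with elim show ?case by (simp add: eval_schur_complement[OF Z] S_def)
  qed
  ultimately obtain F' where F': "F' \<in> carrier_mat n n" "S = F' * para_adjoint F'"
    using Suc.IH S by blast
  define F where "F = mat (Suc n) (Suc n) (\<lambda>(i, j). case j of
      0 \<Rightarrow> (if i = 0 then g else Z $$ (i, 0) / rat_para g)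
    | Suc l \<Rightarrow> (case i of 0 \<Rightarrow> 0 | Suc k \<Rightarrow> F' $$ (k, l)))"
  have F: "F \<in> carrier_mat (Suc n) (Suc n)"
    and F_index: "F $$ (0, 0) = g" "\<And>i. i < n \<Longrightarrow> F $$ (Suc i, 0) = Z $$ (Suc i, 0) / rat_para g"
      "\<And>j. j < n \<Longrightarrow> F $$ (0, Suc j) = 0" "\<And>i j. i < n \<Longrightarrow> j < n \<Longrightarrow> F $$ (Suc i, Suc j) = F' $$ (i, j)"
    by (simp_all add: F_def)
  have "Z = F * para_adjoint F"
  proof (rule eq_matI)
    fix i j assume "i < dim_row (F * para_adjoint F)" "j < dim_col (F * para_adjoint F)"
    then have ij: "i < Suc n" "j < Suc n" using F by auto
    have prod: "(F * para_adjoint F) $$ (i, j) = F $$ (i, 0) * rat_para (F $$ (j, 0)) +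
        (\<Sum>k<n. F $$ (i, Suc k) * rat_para (F $$ (j, Suc k)))"
      using ij F by (simp add: index_mult_mat_sum sum.lessThan_Suc_shift del: index_mult_mat(1) sum.lessThan_Suc)
    show "Z $$ (i, j) = (F * para_adjoint F) $$ (i, j)"
    proof (cases i)
      case 0
      then show ?thesis unfolding prod using ij g0 g para[of j 0]
        by (cases j) (simp_all add: F_index a_def rat_para_mult divide_inverse rat_para_inverse rat_para_para para)
    next
      case i: (Suc i')
      show ?thesis
      proof (cases j)
        case 0
        then show ?thesis unfolding prod using ij i g0 by (simp add: F_index rat_para_0)
      next
        case j: (Suc j')
        have "S $$ (i', j') = (\<Sum>k<n. F' $$ (i', k) * rat_para (F' $$ (j', k)))"
          using ij i j F' by (simp add: index_mult_mat_sum del: index_mult_mat(1))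
        then have "Z $$ (Suc i', Suc j') = Z $$ (Suc i', 0) * Z $$ (0, Suc j') / a
            + (\<Sum>k<n. F' $$ (i', k) * rat_para (F' $$ (j', k)))"
          using ij i j by (simp add: S_index algebra_simps)
        moreover have "Z $$ (Suc i', 0) / rat_para g * rat_para (Z $$ (Suc j', 0) / rat_para g) = Z $$ (Suc i', 0) * Z $$ (0, Suc j') / a"
          using ij i j by (simp add: g rat_para_mult divide_inverse rat_para_inverse rat_para_para para)
        ultimately show ?thesis unfolding prod using ij i j
          by (simp add: F_index)
      qed
    qed
  qed (use F Z in auto)
  with F show ?case by blast
qed

text \<open>A rational null vector would evaluate to a null vector of a positive definite matrix at every
  frequency outside a finite set, hence vanish there.\<close>

lemma rat_mat_det_nonzero:
  assumes Z: "Z \<in> carrier_mat n n" and pd: "\<forall>\<^sub>F t::real in cofinite. pos_def (eval_mat Z (\<i> * of_real t))"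
  shows "det Z \<noteq> 0"
proof
  assume "det Z = 0"
  then obtain v where v: "v \<in> carrier_vec n" "v \<noteq> 0\<^sub>v n" "Z *\<^sub>v v = 0\<^sub>v n"
    using det_0_iff_vec_prod_zero_field[OF Z] by blast
  then obtain k where k: "k < n" "vec_index v k \<noteq> 0" by (auto simp: vec_eq_iff)
  define V where "V = mat n 1 (\<lambda>(i, j). vec_index v i)"
  have V: "V \<in> carrier_mat n 1" by (simp add: V_def)
  have "Z * V = 0\<^sub>m n 1"
    using Z V v by (intro eq_matI) (auto simp: V_def vec_eq_iff scalar_prod_def)
  have "\<forall>\<^sub>F t::real in cofinite. False"
    using pd eventually_regular_mat[of Z] eventually_regular_mat[of V] eventually_axis_nonzero[OF k(2)]
  proof eventually_elim
    case (elim t)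
    let ?s = "\<i> * of_real t :: complex"
    have "eval_mat (0\<^sub>m n 1) ?s = 0\<^sub>m n 1"
      by (rule eq_matI) (auto simp: rat_eval_0_1)
    then have "eval_mat Z ?s * eval_mat V ?s = 0\<^sub>m n 1"
      using eval_mat_mult[OF elim(2,3)] Z V \<open>Z * V = _\<close> by simp
    moreover have "det (eval_mat Z ?s) \<noteq> 0"
      using pos_def_det_nonzero elim(1) Z by auto
    moreover have "eval_mat Z ?s *\<^sub>v col (eval_mat V ?s) 0 = col (eval_mat Z ?s * eval_mat V ?s) 0"
      using Z V by (intro eq_vecI) auto
    moreover have "eval_mat Z ?s \<in> carrier_mat n n" "col (eval_mat V ?s) 0 \<in> carrier_vec n"
      using Z V by auto
    ultimately have "col (eval_mat V ?s) 0 = 0\<^sub>v n"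
      using det_0_iff_vec_prod_zero_field[of "eval_mat Z ?s" n] by fastforce
    then have "vec_index (col (eval_mat V ?s) 0) k = 0" using k by simp
    then show False using elim(4) V k by (simp add: V_def)
  qed
  then show False using cofinite_axis_not_trivial by blast
qed

section \<open>Paraunitary dilation of a strict contraction\<close>

lemma invertible_of_det_nonzero:
  fixes F :: "'a::field mat"
  assumes "F \<in> carrier_mat n n" "det F \<noteq> 0"
  obtains Y where "Y \<in> carrier_mat n n" "F * Y = 1\<^sub>m n" "Y * F = 1\<^sub>m n"
  using det_non_zero_imp_unit[OF assms, of "()"] by (auto simp: Units_def ring_mat_def)

lemma para_adjoint_four_block_mat:
  assumes "A \<in> carrier_mat nr1 nc1" "B \<in> carrier_mat nr1 nc2"
    "C \<in> carrier_mat nr2 nc1" "D \<in> carrier_mat nr2 nc2"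
  shows "para_adjoint (four_block_mat A B C D)
    = four_block_mat (para_adjoint A) (para_adjoint C) (para_adjoint B) (para_adjoint D)"
  using assms by (intro eq_matI) auto

lemma paraunitaryI:
  assumes "H \<in> carrier_mat N N" "H * para_adjoint H = 1\<^sub>m N"
  shows "paraunitary H"
  using assms mat_mult_left_right_inverse[OF assms(1) para_adjoint_carrier[OF assms(1)] assms(2)]
  by (auto simp: paraunitary_def)

text \<open>The two factorizations fix the upper right and the lower left block. Orthogonality of the two block
  rows then leaves only \<open>X = - E K\<^sup>H F\<^sup>-\<^sup>H\<close>. That the second block row is normalized amounts to
  \<open>(I - K\<^sup>H K) (I + W\<^sup>H W) = I\<close> with \<open>W = F\<^sup>-\<^sup>1 K\<close>.\<close>

lemma paraunitary_completion:
  assumes K: "K \<in> carrier_mat n p" and F: "F \<in> carrier_mat n n" and E: "E \<in> carrier_mat p p"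
    and FF: "F * para_adjoint F = 1\<^sub>m n - K * para_adjoint K"
    and EE: "para_adjoint E * E = 1\<^sub>m p - para_adjoint K * K"
    and det: "det F \<noteq> 0"
  shows "\<exists>X\<in>carrier_mat p n. paraunitary (four_block_mat K F E X)"
proof -
  obtain Y where Y: "Y \<in> carrier_mat n n" "F * Y = 1\<^sub>m n" "Y * F = 1\<^sub>m n"
    using invertible_of_det_nonzero[OF F det] .
  define W where "W = Y * K"
  let ?K = "para_adjoint K" and ?F = "para_adjoint F" and ?E = "para_adjoint E" and ?Y = "para_adjoint Y" and ?W = "para_adjoint W"
  define X where "X = - (E * ?W)"
  have W: "W \<in> carrier_mat n p" using Y K by (simp add: W_def)
  have X: "X \<in> carrier_mat p n" using E para_adjoint_carrier[OF W] by (simp add: X_def)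
  note carr = K F E Y(1) W X
  note pcarr = carr[THEN para_adjoint_carrier]
  note mcarr = carr pcarr
  have FW: "F * W = K"
    unfolding W_def using F Y K by (simp flip: assoc_mult_mat[OF F Y(1) K])
  have paraX: "para_adjoint X = - (W * ?E)"
    using E W by (simp add: X_def para_adjoint_uminus para_adjoint_mult[OF E pcarr(5)] para_adjoint_para_adjoint)
  have paraW: "?W = ?K * ?Y"
    by (simp add: W_def para_adjoint_mult[OF Y(1) K])
  have off: "K * ?E + F * para_adjoint X = 0\<^sub>m n p"
  proof -
    have "F * para_adjoint X = - (F * (W * ?E))" using mcarr by (simp add: paraX)
    also have "F * (W * ?E) = K * ?E"
      by (simp flip: assoc_mult_mat[OF F W pcarr(3)] add: FW)
    finally have eq: "F * para_adjoint X = - (K * ?E)" .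
    show ?thesis unfolding eq using mcarr by (intro eq_matI) auto
  qed
  have off': "E * ?K + X * ?F = 0\<^sub>m p n"
  proof -
    have "para_adjoint (K * ?E + F * para_adjoint X) = E * ?K + X * ?F"
      using mcarr by (simp add: para_adjoint_add[of _ n p] para_adjoint_mult[of _ n p _ p] para_adjoint_mult[of _ n n _ p] para_adjoint_para_adjoint)
    moreover have "para_adjoint (0\<^sub>m n p) = 0\<^sub>m p n"
      by (rule eq_matI) (simp_all add: rat_para_0)
    ultimately show ?thesis by (simp add: off)
  qed
  have last: "E * ?E + X * para_adjoint X = 1\<^sub>m p"
  proof -
    define M where "M = 1\<^sub>m p + ?W * W"
    have M: "M \<in> carrier_mat p p" using W pcarr(5) by (simp add: M_def)
    have WW: "?W * W \<in> carrier_mat p p" using W pcarr(5) by simp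
    have KW: "K * ?W = ?Y - F"
    proof -
      have "F * (?F * ?Y) = F"
        using F by (simp add: para_adjoint_mult[OF Y(1) F, symmetric] Y(3) para_adjoint_one)
      then have "(1\<^sub>m n - K * ?K) * ?Y = F"
        using assoc_mult_mat[OF F pcarr(2) pcarr(4)] by (simp add: FF)
      moreover have "(1\<^sub>m n - K * ?K) * ?Y = ?Y - K * ?W"
        using mcarr by (simp add: minus_mult_distrib_mat[of _ n n] paraW assoc_mult_mat[of _ n p _ n _ n])
      ultimately have "?Y - K * ?W = F" by simp
      then show ?thesis
        using mcarr by (auto simp: mat_eq_iff algebra_simps)
    qed
    have KKW: "?K * (K * (?W * W)) = ?W * W - ?K * K"
    proof -
      have "K * (?W * W) = (?Y - F) * W"
        using assoc_mult_mat[OF K pcarr(5) W] by (simp add: KW)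
      also have "\<dots> = ?Y * W - K"
        using mcarr by (simp add: minus_mult_distrib_mat[of _ n n] FW)
      finally have "?K * (K * (?W * W)) = ?K * (?Y * W) - ?K * K"
        by (simp add: mult_minus_distrib_mat[OF pcarr(1) mult_carrier_mat[OF pcarr(4) W] K])
      also have "?K * (?Y * W) = ?W * W"
        using mcarr by (simp add: paraW)
      finally show ?thesis .
    qed
    have "?E * (E * M) = (1\<^sub>m p - ?K * K) * M"
      using assoc_mult_mat[OF pcarr(3) E M] by (simp add: EE)
    also have "\<dots> = M - ?K * (K * M)"
      using mcarr M by (simp add: minus_mult_distrib_mat[of _ p p])
    also have "?K * (K * M) = ?K * K + ?K * (K * (?W * W))"
      using K unfolding M_def
      by (simp add: mult_add_distrib_mat[OF K one_carrier_mat WW]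
          mult_add_distrib_mat[OF pcarr(1) K mult_carrier_mat[OF K WW]])
    also have "\<dots> = ?W * W"
      using mcarr unfolding KKW by (intro eq_matI) auto
    also have "M - ?W * W = 1\<^sub>m p"
      using W unfolding M_def by (intro eq_matI) auto
    \<comment> \<open>a one-sided inverse of a square matrix is two-sided, so the three factors may be rotated\<close>
    finally have "(E * M) * ?E = 1\<^sub>m p"
      using mat_mult_left_right_inverse[OF pcarr(3), of "E * M"] E M by auto
    moreover have "(E * M) * ?E = E * ?E + E * ?W * (W * ?E)"
      using E unfolding M_def
      by (simp add: mult_add_distrib_mat[OF E one_carrier_mat WW]
          add_mult_distrib_mat[OF E mult_carrier_mat[OF E WW] pcarr(3)] assoc_mult_mat[OF E WW pcarr(3)]
          assoc_mult_mat[OF pcarr(5) W pcarr(3)] assoc_mult_mat[OF E pcarr(5) mult_carrier_mat[OF W pcarr(3)]])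
    moreover have "X * para_adjoint X = E * ?W * (W * ?E)"
      unfolding paraX unfolding X_def using mcarr by simp
    ultimately show ?thesis by simp
  qed
  have first: "K * ?K + F * ?F = 1\<^sub>m n"
    unfolding FF using K by (intro eq_matI) auto
  have "four_block_mat K F E X * para_adjoint (four_block_mat K F E X) = 1\<^sub>m (n + p)"
    unfolding para_adjoint_four_block_mat[OF K F E X]
    by (subst mult_four_block_mat[OF K F E X pcarr(1) pcarr(3) pcarr(2) pcarr(6)])
      (simp add: first off off' last)
  moreover have "four_block_mat K F E X \<in> carrier_mat (n + p) (n + p)"
    using K X by (auto simp: add.commute)
  ultimately show ?thesis using X paraunitaryI by blast
qed

lemma paraunitary_scale:
  assumes H: "H \<in> carrier_mat N N" "paraunitary H"
    and d: "\<And>i. i < N \<Longrightarrow> d i * rat_para (d i) = 1" and e: "\<And>i. i < N \<Longrightarrow> e i * rat_para (e i) = 1"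
  shows "paraunitary (mat N N (\<lambda>(i, j). d i * H $$ (i, j) * e j))" (is "paraunitary ?H")
proof (rule paraunitaryI)
  have HH: "H * para_adjoint H = 1\<^sub>m N" using H by (simp add: paraunitary_def)
  show "?H * para_adjoint ?H = 1\<^sub>m N"
  proof (rule eq_matI)
    fix i j assume "i < dim_row (1\<^sub>m N :: rat_mat)" "j < dim_col (1\<^sub>m N :: rat_mat)"
    then have ij: "i < N" "j < N" by auto
    have "(?H * para_adjoint ?H) $$ (i, j) =
        (\<Sum>k<N. d i * rat_para (d j) * (H $$ (i, k) * rat_para (H $$ (j, k))) * (e k * rat_para (e k)))"
      using ij by (simp add: index_mult_mat_sum rat_para_mult mult_ac del: index_mult_mat(1))
    also have "\<dots> = d i * rat_para (d j) * (\<Sum>k<N. H $$ (i, k) * rat_para (H $$ (j, k)))"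
      by (simp add: e sum_distrib_left)
    also have "(\<Sum>k<N. H $$ (i, k) * rat_para (H $$ (j, k))) = 1\<^sub>m N $$ (i, j)"
      using ij H by (simp add: index_mult_mat_sum del: index_mult_mat(1) flip: HH)
    also have "d i * rat_para (d j) * 1\<^sub>m N $$ (i, j) = 1\<^sub>m N $$ (i, j)"
      using ij d by simp
    finally show "(?H * para_adjoint ?H) $$ (i, j) = 1\<^sub>m N $$ (i, j)" .
  qed auto
qed simp

text \<open>The rows of a unitary matrix are unit vectors.\<close>

lemma paraunitary_axis_bounded:
  assumes "paraunitary H" "f \<in> elements_mat H"
  shows "\<forall>\<^sub>F t::real in cofinite. cmod (rat_eval f (\<i> * of_real t)) \<le> 1"
  using eventually_regular_mat[of H]
proof eventually_elim
  case (elim t)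
  let ?s = "\<i> * of_real t :: complex"
  obtain i j where ij: "i < dim_row H" "j < dim_col H" "f = H $$ (i, j)"
    using assms(2) by (auto simp: elements_mat_def)
  have "eval_mat H ?s * mat_adjoint (eval_mat H ?s) = 1\<^sub>m (dim_row H)"
    using eval_mat_mult[OF elim, of "para_adjoint H"] assms(1) elim
    by (simp add: regular_mat_para_adjoint_axis paraunitary_def eval_mat_para_adjoint_axis eval_mat_one)
  from arg_cong[OF this, of "\<lambda>A. A $$ (i, i)"]
  have "1 = (\<Sum>k<dim_col H. rat_eval (H $$ (i, k)) ?s * cnj (rat_eval (H $$ (i, k)) ?s))"
    using ij by (simp add: index_mult_mat_sum del: index_mult_mat(1))
  also have "\<dots> = of_real (\<Sum>k<dim_col H. (cmod (rat_eval (H $$ (i, k)) ?s))\<^sup>2)"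
    unfolding of_real_sum by (simp only: complex_norm_square)
  finally have "(\<Sum>k<dim_col H. (cmod (rat_eval (H $$ (i, k)) ?s))\<^sup>2) = 1"
    by (metis of_real_eq_1_iff)
  moreover have "(cmod (rat_eval f ?s))\<^sup>2 \<le> (\<Sum>k<dim_col H. (cmod (rat_eval (H $$ (i, k)) ?s))\<^sup>2)"
    unfolding ij(3) using ij(2) by (intro member_le_sum) auto
  ultimately show ?case by (simp add: power_le_one_iff)
qed

text \<open>A paraunitary completion of \<open>K\<close> exists over the field of rational functions; its other blocks may have poles in
  the right half-plane. Multiplying the lower block row and the right block column by an all-pass
  function \<open>b\<close> that cancels these poles keeps the matrix paraunitary and leaves \<open>K\<close>, which is
  stable by hypothesis, untouched. There are no poles on the axis or at infinity,
  because the entries of a paraunitary matrix are bounded there. The completion uses \<open>n\<close> environment inputs.\<close>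

lemma contraction_dilation:
  assumes K: "K \<in> carrier_mat n p" and stable: "stable_rat K"
    and strict: "\<And>t::real. pos_def (1\<^sub>m n - eval_mat K (\<i> * of_real t) * mat_adjoint (eval_mat K (\<i> * of_real t)))"
  shows "\<exists>H\<in>admissible n p. block11 n p H = K"
proof -
  let ?Z1 = "1\<^sub>m n - K * para_adjoint K" and ?Z2 = "1\<^sub>m p - para_adjoint K * K"
  have Kp: "para_adjoint K \<in> carrier_mat p n" using K by auto
  have "\<forall>\<^sub>F t::real in cofinite. pos_def (eval_mat ?Z1 (\<i> * of_real t)) \<and> pos_def (eval_mat ?Z2 (\<i> * of_real t))"
    using eventually_regular_mat[of K]
  proof eventually_elim
    case (elim t)
    from eval_gram_defect_swap[OF elim K] eval_gram_defect[OF elim K] strict[of t] pos_def_gram_defect_swap[of "eval_mat K (\<i> * of_real t)" n p] K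
    show ?case by simp
  qed
  then have pd: "\<forall>\<^sub>F t::real in cofinite. pos_def (eval_mat ?Z1 (\<i> * of_real t))"
    "\<forall>\<^sub>F t::real in cofinite. pos_def (eval_mat ?Z2 (\<i> * of_real t))"
    by (auto elim: eventually_mono)
  have Z: "?Z1 \<in> carrier_mat n n" "?Z2 \<in> carrier_mat p p" using K by auto
  have "para_adjoint ?Z1 = ?Z1" "para_adjoint ?Z2 = ?Z2"
    using K Kp by (simp_all add: para_adjoint_minus[of _ n n] para_adjoint_minus[of _ p p] para_adjoint_one
        para_adjoint_mult[OF K Kp] para_adjoint_mult[OF Kp K] para_adjoint_para_adjoint)
  then obtain F E' where F: "F \<in> carrier_mat n n" "?Z1 = F * para_adjoint F"
    and E': "E' \<in> carrier_mat p p" "?Z2 = E' * para_adjoint E'"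
    using mat_spectral_factor[OF Z(1) _ pd(1)] mat_spectral_factor[OF Z(2) _ pd(2)] by blast
  define E where "E = para_adjoint E'"
  have E: "E \<in> carrier_mat p p" "?Z2 = para_adjoint E * E" using E' by (auto simp: E_def para_adjoint_para_adjoint)
  have "det F \<noteq> 0"
    using rat_mat_det_nonzero[OF Z(1) pd(1)] det_mult[OF F(1) para_adjoint_carrier[OF F(1)]] F(2) by auto
  then obtain X where X: "X \<in> carrier_mat p n" "paraunitary (four_block_mat K F E X)"
    using paraunitary_completion[OF K F(1) E(1)] F E by metis
  define H0 where "H0 = four_block_mat K F E X"
  have H0: "H0 \<in> carrier_mat (p + n) (p + n)" using K X by (auto simp: H0_def add.commute)
  have "finite (elements_mat H0)" by (simp add: elements_mat_def)
  then obtain b where b: "b * rat_para b = 1" "rhp_regular b" "\<forall>f\<in>elements_mat H0. rhp_regular (b * f)"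
    using blaschke_for_finite_set by blast
  define d where "d i = (if i < n then 1 else b)" for i :: nat
  define e where "e j = (if j < p then 1 else b)" for j :: nat
  define H where "H = mat (p + n) (p + n) (\<lambda>(i, j). d i * H0 $$ (i, j) * e j)"
  have "paraunitary H"
    unfolding H_def by (intro paraunitary_scale H0 X(2)[folded H0_def]) (auto simp: d_def e_def b rat_para_1)
  \<comment> \<open>outside the upper left block the entry carries the factor \<open>b\<close> once or twice\<close>
  have "rhp_regular f" if f: "f \<in> elements_mat H" for f
  proof -
    obtain i j where ij: "i < p + n" "j < p + n" "f = d i * H0 $$ (i, j) * e j"
      using f by (auto simp: H_def elements_mat_def)
    have bf: "rhp_regular (b * H0 $$ (i, j))" using b(3) ij(1,2) H0 by auto
    show ?thesis
    proof (cases "i < n \<and> j < p")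
      case True
      then have "K $$ (i, j) \<in> elements_mat K" using K by auto
      with stable have "rat_poles (K $$ (i, j)) \<subseteq> {s. Re s < 0}" by (auto simp: stable_rat_def)
      then have "rhp_regular (K $$ (i, j))" by (force simp: rhp_regular_def)
      then show ?thesis using True ij K X by (simp add: H0_def d_def e_def)
    next
      case False
      then show ?thesis using ij(3) bf rhp_regular_mult[OF bf b(2)] by (auto simp: d_def e_def mult_ac)
    qed
  qed
  then have "stable_rat H" "hardy_inf H"
    using stable_hardy_of_axis_bounded[of H] paraunitary_axis_bounded[OF \<open>paraunitary H\<close>] by auto
  moreover have "H \<in> carrier_mat (p + n) (p + n)" by (simp add: H_def)
  ultimately have "H \<in> admissible n p"
    using \<open>paraunitary H\<close> unfolding admissible_def by (auto intro!: exI[of _ n])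
  moreover have "block11 n p H = K"
    using K X by (intro eq_matI) (auto simp: block11_def split_block_def Let_def H_def H0_def d_def e_def)
  ultimately show ?thesis by blast
qed

section \<open>Normal rank\<close>

lemma normal_rank_full:
  assumes Z: "Z \<in> carrier_mat n n" and "det Z \<noteq> 0"
  shows "normal_rank Z = n"
proof -
  have "submatrix Z {..<n} {..<n} = Z"
  proof (rule eq_matI)
    fix i j assume ij: "i < dim_row Z" "j < dim_col Z"
    have "{a \<in> {..<n}. a < k} = {..<k}" if "k < n" for k :: nat using that by auto
    then show "submatrix Z {..<n} {..<n} $$ (i, j) = Z $$ (i, j)"
      using submatrix_index_card[of i Z j "{..<n}" "{..<n}"] ij Z by simp
  qed (use Z in \<open>auto simp: dim_submatrix\<close>)
  then have "has_nonzero_minor Z n"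
    using assms unfolding has_nonzero_minor_def by (intro exI[of _ "{..<n}"]) auto
  moreover have "\<not> has_nonzero_minor Z r" if "r > n" for r
  proof
    assume "has_nonzero_minor Z r"
    then obtain I where "I \<subseteq> {..<n}" "card I = r"
      using Z by (auto simp: has_nonzero_minor_def)
    with that card_mono[of "{..<n}" I] show False by simp
  qed
  ultimately show ?thesis
    unfolding normal_rank_def by (intro the1_equality normal_rank_wellposed) auto
qed

text \<open>Both ranks are full.\<close>

lemma rank_const_on_axis_of_pos_def:
  assumes Z: "Z \<in> carrier_mat n n" and pd: "\<And>t::real. pos_def (eval_mat Z (\<i> * of_real t))"
  shows "rank_const_on_axis Z"
proof -
  have "normal_rank Z = n"
    using Z pd by (intro normal_rank_full rat_mat_det_nonzero) auto
  moreover have "vec_space.rank n (eval_mat Z (\<i> * of_real t)) = n" for t :: real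
    using vec_space.det_rank_iff[of "eval_mat Z (\<i> * of_real t)" n] pos_def_det_nonzero[OF _ pd] Z by auto
  ultimately show ?thesis using Z by (simp add: rank_const_on_axis_def)
qed

lemma pos_def_imp_pos_semidef:
  assumes "pos_def M"
  shows "pos_semidef M"
  unfolding pos_semidef_def
proof (intro conjI ballI)
  fix v :: "complex vec" assume "v \<in> carrier_vec (dim_row M)"
  then show "0 \<le> Re ((M *\<^sub>v v) \<bullet>c v)"
  proof (cases "v = 0\<^sub>v (dim_row M)")
    case True
    then have "(M *\<^sub>v v) \<bullet>c v = 0" unfolding cinner_sum by simp
    then show ?thesis by simp
  next
    case False
    with \<open>v \<in> _\<close> show ?thesis using assms by (simp add: pos_def_def less_imp_le)
  qed
qed (use assms in \<open>auto simp: pos_def_def\<close>)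

section \<open>Filters with a strictly contractive upper left block\<close>

theorem theorem1:
  fixes m n nw ny nd :: nat
    and A B C D Su Sw :: "complex mat"
    and G :: rat_mat
    and \<gamma> :: real
  assumes dims: "ny + nd = n + nw"
    and A_hurwitz: "hurwitz A"
    and minimal: "minimal_realization m (ny + nd) (n + nw) A B C D"
    and lyapunov: "A + mat_adjoint A + B * mat_adjoint B = 0\<^sub>m m m"
    and B_eq: "B = - (mat_adjoint C * D)"
    and D_unitary: "mat_adjoint D * D = 1\<^sub>m (n + nw)" "D * mat_adjoint D = 1\<^sub>m (n + nw)"
    and G_def: "G = transfer_function A B C D"
    and Su: "Su \<in> carrier_mat n n" "pos_def Su"
    and Sw: "Sw \<in> carrier_mat nw nw" "pos_def Sw"
    and \<gamma>_pos: "\<gamma> > 0"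
    and nonempty: "H11_minus n ny Su Sw G \<gamma> \<noteq> {}"
  shows
    "(\<forall>H11 \<in> H11_minus n ny Su Sw G \<gamma>.
        stable_rat H11 \<and>
        (\<forall>\<omega>::real. eval_mat H11 (\<i> * complex_of_real \<omega>) *
            mat_adjoint (eval_mat H11 (\<i> * complex_of_real \<omega>)) \<preceq>\<^sub>L 1\<^sub>m n) \<and>
        rank_const_on_axis (1\<^sub>m n - H11 * para_adjoint H11) \<and>
        rank_const_on_axis (1\<^sub>m ny - para_adjoint H11 * H11)) \<and>
     (\<forall>H11 \<in> H11_minus n ny Su Sw G \<gamma>.
        \<exists>H \<in> admissible n ny. block11 n ny H = H11 \<and>
          error_below n ny Su Sw G \<gamma> (block11 n ny H)) \<and>
     Inf {g. g > 0 \<and> (\<exists>H \<in> admissible n ny. block11 n ny H \<in> H11_minus n ny Su Sw G g)} =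
       gamma_opt'' n ny Su Sw G \<and>
     gamma_opt'' n ny Su Sw G \<ge> gamma_opt n ny Su Sw G"
proof -
  have carrier: "K \<in> carrier_mat n ny" and stable: "stable_rat K" and error: "error_below n ny Su Sw G g K"
    and strict: "\<And>t::real. pos_def (1\<^sub>m n - eval_mat K (\<i> * of_real t) * mat_adjoint (eval_mat K (\<i> * of_real t)))"
    if "K \<in> H11_minus n ny Su Sw G g" for K g
  proof -
    show "pos_def (1\<^sub>m n - eval_mat K (\<i> * of_real t) * mat_adjoint (eval_mat K (\<i> * of_real t)))" for t :: real
      using that by (auto simp: H11_minus_def loewner_less_def rat_axis_val_def dest!: spec[of _ "ereal t"])
  qed (use that in \<open>auto simp: H11_minus_def\<close>)
  have dilation: "\<exists>H\<in>admissible n ny. block11 n ny H = K" if "K \<in> H11_minus n ny Su Sw G g" for K g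
    using contraction_dilation[OF carrier[OF that] stable[OF that] strict[OF that]] .
  have "stable_rat K \<and>
      (\<forall>\<omega>::real. eval_mat K (\<i> * of_real \<omega>) * mat_adjoint (eval_mat K (\<i> * of_real \<omega>)) \<preceq>\<^sub>L 1\<^sub>m n) \<and>
      rank_const_on_axis (1\<^sub>m n - K * para_adjoint K) \<and>
      rank_const_on_axis (1\<^sub>m ny - para_adjoint K * K)"
    if "K \<in> H11_minus n ny Su Sw G \<gamma>" for K
  proof (intro conjI allI)
    note K = carrier[OF that] and pd = strict[OF that]
    show "stable_rat K" by (rule stable[OF that])
    have reg: "regular_mat K (\<i> * of_real t)" for t :: real
      using stable[OF that] by (force simp: stable_rat_def regular_mat_def)
    show "eval_mat K (\<i> * of_real t) * mat_adjoint (eval_mat K (\<i> * of_real t)) \<preceq>\<^sub>L 1\<^sub>m n" for t :: real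
      unfolding loewner_le_def by (rule pos_def_imp_pos_semidef[OF pd])
    show "rank_const_on_axis (1\<^sub>m n - K * para_adjoint K)"
      using K pd by (intro rank_const_on_axis_of_pos_def[of _ n]) (auto simp: eval_gram_defect[OF reg K])
    show "rank_const_on_axis (1\<^sub>m ny - para_adjoint K * K)"
      using K pos_def_gram_defect_swap[OF _ pd] by (intro rank_const_on_axis_of_pos_def[of _ ny]) (auto simp: eval_gram_defect_swap[OF reg K])
  qed
  moreover have "\<exists>H\<in>admissible n ny. block11 n ny H = K \<and> error_below n ny Su Sw G \<gamma> (block11 n ny H)"
    if "K \<in> H11_minus n ny Su Sw G \<gamma>" for K
    using dilation[OF that] error[OF that] by auto
  moreover have "Inf {g. g > 0 \<and> (\<exists>H\<in>admissible n ny. block11 n ny H \<in> H11_minus n ny Su Sw G g)} =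
      gamma_opt'' n ny Su Sw G"
    unfolding gamma_opt''_def using dilation by (intro arg_cong[of _ _ Inf]) fastforce
  moreover have "gamma_opt n ny Su Sw G \<le> gamma_opt'' n ny Su Sw G"
    unfolding gamma_opt_def gamma_opt''_def
  proof (rule cInf_superset_mono)
    show "{\<gamma>. \<gamma> > 0 \<and> H11_minus n ny Su Sw G \<gamma> \<noteq> {}} \<noteq> {}" using \<gamma>_pos nonempty by blast
    show "bdd_below {\<gamma>. \<gamma> > 0 \<and> (\<exists>H\<in>admissible n ny. error_below n ny Su Sw G \<gamma> (block11 n ny H))}"
      by (rule bdd_belowI[of _ 0]) auto
    show "{\<gamma>. \<gamma> > 0 \<and> H11_minus n ny Su Sw G \<gamma> \<noteq> {}}
        \<subseteq> {\<gamma>. \<gamma> > 0 \<and> (\<exists>H\<in>admissible n ny. error_below n ny Su Sw G \<gamma> (block11 n ny H))}"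
      using dilation error by fastforce
  qed
  ultimately show ?thesis by blast
qed

end
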